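(* Let $A\subseteq\omega$. Assume there is no left c.e. set $X\subseteq\omega$ such that $\{n:X(n)=A(n)\}$ is density-1. Then $A$ is density-1-bounding in the generic degrees.
   Context: A real is a subset of $\omega$, identified with its characteristic function $\omega\to\{0,1\}$. A real $X$ is density-1 if $\lim_{n\to\infty}|X\cap n|/n=1$, where $n=\{0,\dots,n-1\}$. A real is left c.e. if it is the leftmost (infinite) path of some computable tree in $2^{<\omega}$. A (time-dependent) partial oracle $(A)$ for a real $A$ is a set of triples $\langle n,x,l\rangle$ with $n,l\in\omega$, $x\in\{0,1\}$, such that $\langle n,x,l\rangle\in(A)$ implies $A(n)=x$, and for every $n,x$ there is at most one $l$ with $\langle n,x,l\rangle\in(A)$. Its domain is the set of $n$ for which some $\langle n,x,l\rangle\in(A)$ exists. A Turing functional $\phi$ uses $(A)$ as an ordinary oracle for this set of triples. A generic oracle for $A$ is a partial oracle for $A$ with density-1 domain. A generic computation of $B$ is a partial function $\psi$ computed by some machine (possibly with an oracle), with density-1 domain, such that $\psi(n)=B(n)$ whenever $\psi(n)\downarrow$. $B$ is generically computable if it has a generic computation without oracle. $B\leq_{\mathrm{g}}A$ if there is a single Turing functional $\phi$ such that for every generic oracle $(A)$ for $A$, $\phi^{(A)}$ is a generic computation of $B$. The generic degrees are the equivalence classes induced by $\leq_{\mathrm{g}}$; the zero degree consists of the generically computable reals. A real $A$ is density-1-bounding (in the generic degrees) if there is a density-1 real $B$ that is not generically computable with $B\leq_{\mathrm{g}}A$. *)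

theory Defs
  imports
    Complex_Main
    "HOL-Library.Nat_Bijection"
    "HOL-Library.Sublist"
    "HOL-Library.Fun_Lexorder"
begin

section \<open>Oracle machines\<close>

text \<open>
  Machines are programs for the partial recursive functions relative to an oracle
  \<open>Q \<subseteq> \<omega>\<close>. All functions are unary; several arguments are passed through the Cantor
  pairing function \<^const>\<open>prod_encode\<close>, whose projections are therefore among the basic functions.
\<close>

datatype machine =
    Zero_m
  | Succ_m
  | Fst_m
  | Snd_m
  | Query_m
  | Pair_m machine machine
  | Comp_m machine machine
  | Rec_m machine machine
  | Mu_m machine

text \<open>
  A machine that contains \<open>Query_m\<close> is a Turing functional: \<open>run Q p\<close> is the partial function
  that it computes with oracle \<open>Q\<close>. The search in \<open>Mu_m\<close> converges only if all values
  before the first zero are defined.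
\<close>

primrec run :: "nat set \<Rightarrow> machine \<Rightarrow> nat \<rightharpoonup> nat" where
  "run Q Zero_m = (\<lambda>x. Some 0)"
| "run Q Succ_m = (\<lambda>x. Some (Suc x))"
| "run Q Fst_m = (\<lambda>x. Some (fst (prod_decode x)))"
| "run Q Snd_m = (\<lambda>x. Some (snd (prod_decode x)))"
| "run Q Query_m = (\<lambda>x. Some (of_bool (x \<in> Q)))"
| "run Q (Pair_m p q) =
    (\<lambda>x. Option.bind (run Q p x) (\<lambda>a. Option.bind (run Q q x) (\<lambda>b. Some (prod_encode (a, b)))))"
| "run Q (Comp_m p q) = (\<lambda>x. Option.bind (run Q q x) (run Q p))"
| "run Q (Rec_m p q) =
    (\<lambda>x. rec_nat (run Q p (fst (prod_decode x)))
      (\<lambda>m r. Option.bind r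
        (\<lambda>v. run Q q (prod_encode (fst (prod_decode x), prod_encode (m, v)))))
      (snd (prod_decode x)))"
| "run Q (Mu_m p) =
    (\<lambda>x. if \<exists>n. run Q p (prod_encode (x, n)) = Some 0
               \<and> (\<forall>m<n. run Q p (prod_encode (x, m)) \<noteq> None)
          then Some (LEAST n. run Q p (prod_encode (x, n)) = Some 0)
          else None)"

primrec oracle_free :: "machine \<Rightarrow> bool" where
  "oracle_free Zero_m \<longleftrightarrow> True"
| "oracle_free Succ_m \<longleftrightarrow> True"
| "oracle_free Fst_m \<longleftrightarrow> True"
| "oracle_free Snd_m \<longleftrightarrow> True"
| "oracle_free Query_m \<longleftrightarrow> False"
| "oracle_free (Pair_m p q) \<longleftrightarrow> oracle_free p \<and> oracle_free q"
| "oracle_free (Comp_m p q) \<longleftrightarrow> oracle_free p \<and> oracle_free q"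
| "oracle_free (Rec_m p q) \<longleftrightarrow> oracle_free p \<and> oracle_free q"
| "oracle_free (Mu_m p) \<longleftrightarrow> oracle_free p"

text \<open>The choice of the empty oracle in the next definition is therefore immaterial.\<close>

lemma run_oracle_free: "oracle_free p \<Longrightarrow> run Q p = run Q' p"
  by (induction p) (simp_all cong: if_cong)

definition partial_computable :: "(nat \<rightharpoonup> nat) \<Rightarrow> bool" where
  "partial_computable \<psi> \<longleftrightarrow> (\<exists>p. oracle_free p \<and> \<psi> = run {} p)"

definition computable_set :: "nat set \<Rightarrow> bool" where
  "computable_set S \<longleftrightarrow> partial_computable (\<lambda>n. Some (of_bool (n \<in> S)))"

section \<open>Left c.e. reals\<close>

definition is_tree :: "bool list set \<Rightarrow> bool" where
  "is_tree T \<longleftrightarrow> (\<forall>\<sigma>\<in>T. \<forall>\<tau>. prefix \<tau> \<sigma> \<longrightarrow> \<tau> \<in> T)"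

definition string_code :: "bool list \<Rightarrow> nat" where
  "string_code \<sigma> = list_encode (map of_bool \<sigma>)"

definition computable_tree :: "bool list set \<Rightarrow> bool" where
  "computable_tree T \<longleftrightarrow> is_tree T \<and> computable_set (string_code ` T)"

definition is_path :: "nat set \<Rightarrow> bool list set \<Rightarrow> bool" where
  "is_path X T \<longleftrightarrow> (\<forall>n. map (\<lambda>i. i \<in> X) [0..<n] \<in> T)"

text \<open>Left means lexicographically smaller, with \<^term>\<open>False < True\<close> on characteristic functions.\<close>

definition leftmost_path :: "nat set \<Rightarrow> bool list set \<Rightarrow> bool" where
  "leftmost_path X T \<longleftrightarrow>
    is_path X T \<and> (\<forall>Y. is_path Y T \<longrightarrow> Y = X \<or> less_fun (\<lambda>i. i \<in> X) (\<lambda>i. i \<in> Y))"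

definition left_ce :: "nat set \<Rightarrow> bool" where
  "left_ce X \<longleftrightarrow> (\<exists>T. computable_tree T \<and> leftmost_path X T)"

section \<open>Generic computability\<close>

definition density_1 :: "nat set \<Rightarrow> bool" where
  "density_1 X \<longleftrightarrow> (\<lambda>n. real (card (X \<inter> {..<n})) / real n) \<longlonglongrightarrow> 1"

definition partial_oracle :: "(nat \<times> bool \<times> nat) set \<Rightarrow> nat set \<Rightarrow> bool" where
  "partial_oracle P A \<longleftrightarrow>
    (\<forall>n x l. (n, x, l) \<in> P \<longrightarrow> (n \<in> A \<longleftrightarrow> x)) \<and>
    (\<forall>n x l l'. (n, x, l) \<in> P \<longrightarrow> (n, x, l') \<in> P \<longrightarrow> l = l')"

definition oracle_domain :: "(nat \<times> bool \<times> nat) set \<Rightarrow> nat set" where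
  "oracle_domain P = {n. \<exists>x l. (n, x, l) \<in> P}"

definition generic_oracle :: "(nat \<times> bool \<times> nat) set \<Rightarrow> nat set \<Rightarrow> bool" where
  "generic_oracle P A \<longleftrightarrow> partial_oracle P A \<and> density_1 (oracle_domain P)"

definition triple_code :: "nat \<times> bool \<times> nat \<Rightarrow> nat" where
  "triple_code = (\<lambda>(n, x, l). prod_encode (n, prod_encode (of_bool x, l)))"

definition generic_computation :: "(nat \<rightharpoonup> nat) \<Rightarrow> nat set \<Rightarrow> bool" where
  "generic_computation \<psi> B \<longleftrightarrow>
    density_1 (dom \<psi>) \<and> (\<forall>n y. \<psi> n = Some y \<longrightarrow> y = of_bool (n \<in> B))"

definition generically_computable :: "nat set \<Rightarrow> bool" where
  "generically_computable B \<longleftrightarrow> (\<exists>\<psi>. partial_computable \<psi> \<and> generic_computation \<psi> B)"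

definition generic_reducible :: "nat set \<Rightarrow> nat set \<Rightarrow> bool"  (infix "\<le>\<^sub>g" 50) where
  "B \<le>\<^sub>g A \<longleftrightarrow>
    (\<exists>\<phi>. \<forall>P. generic_oracle P A \<longrightarrow> generic_computation (run (triple_code ` P) \<phi>) B)"

definition density_1_bounding :: "nat set \<Rightarrow> bool" where
  "density_1_bounding A \<longleftrightarrow> (\<exists>B. density_1 B \<and> \<not> generically_computable B \<and> B \<le>\<^sub>g A)"

end

theory Submission
  imports Defs
begin

text \<open>
  The blocks of column \<open>e\<close>, one for every level \<open>s\<close>, are used against the \<open>e\<close>-th program. At stage \<open>s\<close>
  a string \<open>\<tau>\<close> is assigned to the block at level \<open>s\<close>, and the block is put into the set \<open>B\<close> iff \<open>\<tau>\<close> is not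
  a prefix of \<open>A\<close>. So when the program outputs \<open>1\<close> somewhere in the block, it claims that \<open>\<tau>\<close> is not a
  prefix of \<open>A\<close>, and from then on all extensions of \<open>\<tau>\<close> are excluded. The next \<open>\<tau>\<close> is the shortest prefix not
  yet assigned of the leftmost string that is not excluded. The leftmost strings converge
  from the left to a left c.e. real \<open>X\<close>, and the assigned strings converge to \<open>X\<close> as well.

  As \<open>X\<close> does not agree with \<open>A\<close> on a set of density 1, every generic oracle for \<open>A\<close> has a position in its
  domain where \<open>A\<close> and \<open>X\<close> differ, and thereby refutes almost all strings assigned in a given column.
  Hence \<open>B\<close> has density 1 and \<open>B \<le>\<^sub>g A\<close>. If the \<open>e\<close>-th program were a generic computation of \<open>B\<close>, its claims
  would be true. Every prefix of \<open>X\<close> is assigned to some block, and is never excluded,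
  so the program is undefined on almost all these blocks. Its domain then does not have density 1.
\<close>

section \<open>Computable functions\<close>

abbreviation pr :: "nat \<Rightarrow> nat \<Rightarrow> nat" where "pr a b \<equiv> prod_encode (a, b)"
abbreviation p1 :: "nat \<Rightarrow> nat" where "p1 z \<equiv> fst (prod_decode z)"
abbreviation p2 :: "nat \<Rightarrow> nat" where "p2 z \<equiv> snd (prod_decode z)"

definition computable_fun :: "(nat \<Rightarrow> nat) \<Rightarrow> bool" where
  "computable_fun f \<longleftrightarrow> (\<exists>p. oracle_free p \<and> (\<forall>Q. run Q p = (\<lambda>x. Some (f x))))"

definition decidable :: "(nat \<Rightarrow> bool) \<Rightarrow> bool" where
  "decidable P \<longleftrightarrow> computable_fun (\<lambda>x. of_bool (P x))"

lemma computable_funI: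
  assumes "oracle_free p" "\<And>Q x. run Q p x = Some (f x)"
  shows "computable_fun f"
  using assms unfolding computable_fun_def by blast

lemma computable_funE:
  assumes "computable_fun f"
  obtains p where "oracle_free p" "\<And>Q x. run Q p x = Some (f x)"
  using assms unfolding computable_fun_def by auto

lemma computable_set_iff_decidable: "computable_set S \<longleftrightarrow> decidable (\<lambda>n. n \<in> S)"
proof -
  have "(\<forall>Q. run Q p = f) \<longleftrightarrow> f = run {} p" if "oracle_free p" for p f
    using run_oracle_free[OF that] by auto
  then show ?thesis
    unfolding computable_set_def partial_computable_def decidable_def computable_fun_def by blast
qed

lemma computable_id: "computable_fun (\<lambda>x. x)"
  by (rule computable_funI[of "Pair_m Fst_m Snd_m"]) auto

lemma computable_comp:
  assumes "computable_fun f" "computable_fun g"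
  shows "computable_fun (\<lambda>x. f (g x))"
proof -
  obtain p where "oracle_free p" "\<And>Q x. run Q p x = Some (f x)"
    using assms(1) by (rule computable_funE) (rule that)
  moreover obtain q where "oracle_free q" "\<And>Q x. run Q q x = Some (g x)"
    using assms(2) by (rule computable_funE) (rule that)
  ultimately show ?thesis
    by (intro computable_funI[of "Comp_m p q"]) auto
qed

lemma computable_pair:
  assumes "computable_fun f" "computable_fun g"
  shows "computable_fun (\<lambda>x. pr (f x) (g x))"
proof -
  obtain p where "oracle_free p" "\<And>Q x. run Q p x = Some (f x)"
    using assms(1) by (rule computable_funE) (rule that)
  moreover obtain q where "oracle_free q" "\<And>Q x. run Q q x = Some (g x)"
    using assms(2) by (rule computable_funE) (rule that)
  ultimately show ?thesis
    by (intro computable_funI[of "Pair_m p q"]) auto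
qed

text \<open>Machines are unary, so a binary \<open>f\<close> is treated through codes of pairs; this
  form lets arbitrary computable arguments be substituted.\<close>

lemma computable_comp2:
  assumes "computable_fun (\<lambda>z. f (p1 z) (p2 z))" "computable_fun a" "computable_fun b"
  shows "computable_fun (\<lambda>x. f (a x) (b x))"
  using computable_comp[OF assms(1) computable_pair[OF assms(2,3)]] by simp

lemma computable_comp3:
  assumes "computable_fun (\<lambda>z. f (p1 z) (p1 (p2 z)) (p2 (p2 z)))"
    "computable_fun a" "computable_fun b" "computable_fun c"
  shows "computable_fun (\<lambda>x. f (a x) (b x) (c x))"
  using computable_comp[OF assms(1) computable_pair[OF assms(2) computable_pair[OF assms(3,4)]]]
  by simp

lemma computable_Suc: "computable_fun f \<Longrightarrow> computable_fun (\<lambda>x. Suc (f x))"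
  by (rule computable_comp[where f = Suc]) (auto intro: computable_funI[of Succ_m])

lemma computable_p1: "computable_fun f \<Longrightarrow> computable_fun (\<lambda>x. p1 (f x))"
  by (rule computable_comp[where f = p1]) (auto intro: computable_funI[of Fst_m])

lemma computable_p2: "computable_fun f \<Longrightarrow> computable_fun (\<lambda>x. p2 (f x))"
  by (rule computable_comp[where f = p2]) (auto intro: computable_funI[of Snd_m])

lemma computable_const: "computable_fun (\<lambda>x. c)"
proof (induction c)
  case 0
  show ?case by (rule computable_funI[of Zero_m]) auto
qed (rule computable_Suc)

lemma computable_rec_nat:
  assumes "computable_fun a" "computable_fun b"
    "computable_fun (\<lambda>z. h (p1 z) (p1 (p2 z)) (p2 (p2 z)))"
  shows "computable_fun (\<lambda>x. rec_nat (a x) (h x) (b x))"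
proof -
  obtain p where p: "oracle_free p" "\<And>Q x. run Q p x = Some (a x)"
    using assms(1) by (rule computable_funE) (rule that)
  obtain q where q: "oracle_free q"
    "\<And>Q z. run Q q z = Some (h (p1 z) (p1 (p2 z)) (p2 (p2 z)))"
    using assms(3) by (rule computable_funE) (rule that)
  have "run Q (Rec_m p q) z = Some (rec_nat (a (p1 z)) (h (p1 z)) (p2 z))" for Q z
  proof -
    have "rec_nat (run Q p (p1 z)) (\<lambda>m r. Option.bind r (\<lambda>v. run Q q (pr (p1 z) (pr m v)))) n
        = Some (rec_nat (a (p1 z)) (h (p1 z)) n)" for n
      by (induction n) (auto simp: p q)
    then show ?thesis by simp
  qed
  then have "computable_fun (\<lambda>z. rec_nat (a (p1 z)) (h (p1 z)) (p2 z))"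
    using p(1) q(1) by (intro computable_funI[of "Rec_m p q"]) auto
  from computable_comp2[OF this computable_id assms(2)] show ?thesis .
qed

lemma computable_add:
  assumes "computable_fun a" "computable_fun b" shows "computable_fun (\<lambda>x. a x + b x)"
proof -
  have "computable_fun (\<lambda>x. rec_nat (a x) (\<lambda>m r. Suc r) (b x))"
    by (intro computable_rec_nat assms computable_Suc computable_p2 computable_id)
  moreover have "rec_nat i (\<lambda>m r. Suc r) j = i + j" for i j
    by (induction j) auto
  ultimately show ?thesis by simp
qed

lemma computable_diff:
  assumes "computable_fun a" "computable_fun b" shows "computable_fun (\<lambda>x. a x - b x)"
proof -
  \<comment> \<open>The predecessor is a recursion that ignores the previous value and returns the
    counter.\<close>
  have "computable_fun (\<lambda>x. rec_nat 0 (\<lambda>m r. m) (a x))" if "computable_fun a" for a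
    by (intro computable_rec_nat that computable_const computable_p1 computable_p2 computable_id)
  moreover have "rec_nat 0 (\<lambda>m r. m) i = i - 1" for i :: nat
    by (cases i) auto
  ultimately have pred: "computable_fun (\<lambda>x. a x - 1)" if "computable_fun a" for a
    using that by simp
  have "computable_fun (\<lambda>x. rec_nat (a x) (\<lambda>m r. r - 1) (b x))"
    by (intro computable_rec_nat assms pred computable_p2 computable_id)
  moreover have "rec_nat i (\<lambda>m r. r - 1) j = i - j" for i j :: nat
    by (induction j) auto
  ultimately show ?thesis by simp
qed

lemma computable_mult:
  assumes "computable_fun a" "computable_fun b" shows "computable_fun (\<lambda>x. a x * b x)"
proof -
  have "computable_fun (\<lambda>x. rec_nat 0 (\<lambda>m r. r + a x) (b x))"
    by (intro computable_rec_nat assms computable_const computable_add computable_p2 computable_id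
        computable_comp[OF assms(1)] computable_p1)
  moreover have "rec_nat 0 (\<lambda>m r. r + i) j = i * j" for i j :: nat
    by (induction j) auto
  ultimately show ?thesis by simp
qed

lemma computable_power:
  assumes "computable_fun a" "computable_fun b" shows "computable_fun (\<lambda>x. a x ^ b x)"
proof -
  have "computable_fun (\<lambda>x. rec_nat 1 (\<lambda>m r. r * a x) (b x))"
    by (intro computable_rec_nat assms computable_const computable_mult computable_p2 computable_id
        computable_comp[OF assms(1)] computable_p1)
  moreover have "rec_nat 1 (\<lambda>m r. r * i) j = i ^ j" for i j :: nat
    by (induction j) auto
  ultimately show ?thesis by simp
qed

lemma computable_funpow:
  assumes "computable_fun f" "computable_fun a" "computable_fun b"
  shows "computable_fun (\<lambda>x. (f ^^ b x) (a x))"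
proof -
  have "computable_fun (\<lambda>x. rec_nat (a x) (\<lambda>m r. f r) (b x))"
    by (intro computable_rec_nat assms computable_comp[OF assms(1)] computable_p2 computable_id)
  moreover have "rec_nat i (\<lambda>m. f) j = (f ^^ j) i" for i j
    by (induction j) auto
  ultimately show ?thesis by simp
qed

section \<open>Decidable predicates, bounded search and division\<close>

lemma decidable_le:
  assumes "computable_fun a" "computable_fun b" shows "decidable (\<lambda>x. a x \<le> b x)"
proof -
  have "computable_fun (\<lambda>x. 1 - (a x - b x))"
    by (intro computable_diff computable_const assms)
  moreover have "1 - (i - j) = of_bool (i \<le> j)" for i j :: nat by auto
  ultimately show ?thesis by (simp add: decidable_def)
qed

lemma decidable_not: "decidable P \<Longrightarrow> decidable (\<lambda>x. \<not> P x)"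
proof -
  assume "decidable P"
  then have "computable_fun (\<lambda>x. 1 - of_bool (P x))"
    unfolding decidable_def by (rule computable_diff[OF computable_const])
  moreover have "1 - of_bool c = (of_bool (\<not> c) :: nat)" for c by simp
  ultimately show ?thesis by (simp add: decidable_def)
qed

lemma decidable_conj: "decidable P \<Longrightarrow> decidable Q \<Longrightarrow> decidable (\<lambda>x. P x \<and> Q x)"
  unfolding decidable_def of_bool_conj by (rule computable_mult)

lemma decidable_disj: "decidable P \<Longrightarrow> decidable Q \<Longrightarrow> decidable (\<lambda>x. P x \<or> Q x)"
  using decidable_not[OF decidable_conj[OF decidable_not[of P] decidable_not[of Q]]] by simp

lemma decidable_imp: "decidable P \<Longrightarrow> decidable Q \<Longrightarrow> decidable (\<lambda>x. P x \<longrightarrow> Q x)"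
  using decidable_disj[OF decidable_not[of P], of Q] by (simp only: imp_conv_disj)

lemma decidable_less:
  "computable_fun a \<Longrightarrow> computable_fun b \<Longrightarrow> decidable (\<lambda>x. a x < b x)"
  using decidable_not[OF decidable_le[of b a]] by (simp add: not_le)

lemma decidable_eq:
  "computable_fun a \<Longrightarrow> computable_fun b \<Longrightarrow> decidable (\<lambda>x. a x = b x)"
  using decidable_conj[OF decidable_le[of a b] decidable_le[of b a]]
  by (simp only: order_eq_iff)

lemma decidable_comp: "decidable P \<Longrightarrow> computable_fun a \<Longrightarrow> decidable (\<lambda>x. P (a x))"
  unfolding decidable_def by (rule computable_comp)

lemma decidable_comp2:
  assumes "decidable (\<lambda>z. P (p1 z) (p2 z))" "computable_fun a" "computable_fun b"
  shows "decidable (\<lambda>x. P (a x) (b x))"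
  using decidable_comp[OF assms(1) computable_pair[OF assms(2,3)]] by simp

lemma computable_if:
  assumes "decidable P" "computable_fun a" "computable_fun b"
  shows "computable_fun (\<lambda>x. if P x then a x else b x)"
proof -
  have "computable_fun (\<lambda>x. of_bool (P x) * a x + of_bool (\<not> P x) * b x)"
    by (intro computable_add computable_mult assms decidable_not[OF assms(1), unfolded decidable_def]
        assms(1)[unfolded decidable_def])
  moreover have "of_bool c * i + of_bool (\<not> c) * j = (if c then i else j)" for c and i j :: nat
    by simp
  ultimately show ?thesis by simp
qed

lemma computable_Least:
  assumes "decidable (\<lambda>z. P (p1 z) (p2 z))" "\<And>x. \<exists>n. P x n"
  shows "computable_fun (\<lambda>x. LEAST n. P x n)"
proof -
  \<comment> \<open>\<open>Mu_m\<close> looks for a zero, so \<open>p\<close> has to compute the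
    negation of \<open>P\<close>.\<close>
  obtain p where p: "oracle_free p"
    "\<And>Q z. run Q p z = Some (of_bool (\<not> P (p1 z) (p2 z)))"
    using decidable_not[OF assms(1)] unfolding decidable_def by (rule computable_funE) (rule that)
  then show ?thesis
    using assms(2) by (intro computable_funI[of "Mu_m p"]) auto
qed

text \<open>Searching for a witness or the bound itself always terminates; the result lies below the
  bound exactly if a witness does.\<close>

lemma decidable_bex_less:
  assumes "decidable (\<lambda>z. P (p1 z) (p2 z))" "computable_fun b"
  shows "decidable (\<lambda>x. \<exists>n<b x. P x n)"
proof -
  have "computable_fun (\<lambda>x. LEAST n. b x \<le> n \<or> P x n)"
    by (intro computable_Least decidable_disj assms decidable_le computable_comp[OF assms(2)]
        computable_p1 computable_p2 computable_id) auto
  then have "decidable (\<lambda>x. (LEAST n. b x \<le> n \<or> P x n) < b x)"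
    by (intro decidable_less assms)
  moreover have "(LEAST n. c \<le> n \<or> R n) < c \<longleftrightarrow> (\<exists>n<c. R n)" for c :: nat and R
  proof
    assume *: "(LEAST n. c \<le> n \<or> R n) < c"
    have "c \<le> (LEAST n. c \<le> n \<or> R n) \<or> R (LEAST n. c \<le> n \<or> R n)"
      by (rule LeastI[of _ c]) simp
    with * show "\<exists>n<c. R n" by auto
  next
    assume "\<exists>n<c. R n"
    then obtain n where "n < c" "R n" by blast
    with Least_le[of "\<lambda>n. c \<le> n \<or> R n" n] show "(LEAST n. c \<le> n \<or> R n) < c" by auto
  qed
  ultimately show ?thesis by simp
qed

lemma decidable_ball_less:
  assumes "decidable (\<lambda>z. P (p1 z) (p2 z))" "computable_fun b"
  shows "decidable (\<lambda>x. \<forall>n<b x. P x n)"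
  using decidable_not[OF decidable_bex_less[OF decidable_not[OF assms(1)] assms(2)]] by simp

lemma computable_div:
  assumes "computable_fun a" "computable_fun b" shows "computable_fun (\<lambda>x. a x div b x)"
proof -
  \<comment> \<open>The disjunct \<open>b x \<le> 0\<close> makes the search stop at 0 for divisor
    0, in accordance with \<open>i div 0 = 0\<close>.\<close>
  have "computable_fun (\<lambda>x. LEAST q. b x \<le> 0 \<or> a x < Suc q * b x)"
  proof (intro computable_Least decidable_disj decidable_le decidable_less computable_mult computable_Suc
        computable_p1 computable_p2 computable_id computable_const
        computable_comp[OF assms(1)] computable_comp[OF assms(2)])
    show "\<exists>q. b x \<le> 0 \<or> a x < Suc q * b x" for x
      by (rule exI[of _ "a x"], cases "b x") auto
  qed
  moreover have "(LEAST q. j \<le> 0 \<or> i < Suc q * j) = i div j" for i j :: nat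
  proof (cases "j = 0")
    case True
    then show ?thesis by (simp add: Least_eq_0)
  next
    case False
    then have "j > 0" by simp
    then have "i < Suc q * j \<longleftrightarrow> i div j \<le> q" for q
      by (simp add: div_less_iff_less_mult flip: less_Suc_eq_le)
    with False show ?thesis by (auto intro: Least_equality)
  qed
  ultimately show ?thesis by simp
qed

lemma computable_mod:
  assumes "computable_fun a" "computable_fun b" shows "computable_fun (\<lambda>x. a x mod b x)"
proof -
  have "computable_fun (\<lambda>x. a x - a x div b x * b x)"
    by (rule computable_diff[OF assms(1) computable_mult[OF computable_div[OF assms] assms(2)]])
  then show ?thesis by (simp add: minus_div_mult_eq_mod)
qed

lemma decidable_dvd:
  assumes "computable_fun a" "computable_fun b" shows "decidable (\<lambda>x. a x dvd b x)"
proof -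
  have "decidable (\<lambda>x. b x mod a x = 0)"
    by (rule decidable_eq[OF computable_mod[OF assms(2,1)] computable_const])
  then show ?thesis unfolding dvd_eq_mod_eq_0 .
qed

lemmas computable_intros = computable_Suc computable_p1 computable_p2 computable_pair
  computable_add computable_diff computable_mult computable_power computable_div computable_mod
  computable_if decidable_le decidable_less decidable_eq decidable_dvd decidable_not decidable_conj
  decidable_disj decidable_imp decidable_bex_less decidable_ball_less computable_id computable_const

section \<open>A universal machine\<close>

primrec machine_code :: "machine \<Rightarrow> nat" where
  "machine_code Zero_m = pr 0 0"
| "machine_code Succ_m = pr 1 0"
| "machine_code Fst_m = pr 2 0"
| "machine_code Snd_m = pr 3 0"
| "machine_code Query_m = pr 4 0"
| "machine_code (Pair_m p q) = pr 5 (pr (machine_code p) (machine_code q))"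
| "machine_code (Comp_m p q) = pr 6 (pr (machine_code p) (machine_code q))"
| "machine_code (Rec_m p q) = pr 7 (pr (machine_code p) (machine_code q))"
| "machine_code (Mu_m p) = pr 8 (pr (machine_code p) 0)"

text \<open>Configurations come in two kinds: tag 2 asks for the value of program \<open>e\<close>
  at \<open>x\<close>, tag 0 hands \<open>v\<close> back to the stack. The dummy 0 in
  \<open>return_conf\<close> keeps the stack at the same position in both.\<close>

abbreviation eval_conf :: "nat \<Rightarrow> nat \<Rightarrow> nat \<Rightarrow> nat" where
  "eval_conf e x K \<equiv> pr 2 (pr e (pr x K))"

abbreviation return_conf :: "nat \<Rightarrow> nat \<Rightarrow> nat" where
  "return_conf v K \<equiv> pr 0 (pr 0 (pr v K))"

abbreviation frame :: "nat \<Rightarrow> nat \<Rightarrow> nat \<Rightarrow> nat \<Rightarrow> nat \<Rightarrow> nat" where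
  "frame t a b c K \<equiv> pr t (pr a (pr b (pr c K)))"

text \<open>\<open>K\<close> is the stack of pending computations, a nested tuple of frames ending in \<open>0\<close>. The tags 1 to 5
  of the frames stand for: evaluate the second component of a pair, form the pair, apply the outer
  function of a composition, continue a recursion, continue a search.\<close>

definition eval_step :: "nat \<Rightarrow> nat \<Rightarrow> nat \<Rightarrow> nat" where
  "eval_step e x K =
    (if p1 e = 0 then return_conf 0 K
     else if p1 e = 1 then return_conf (Suc x) K
     else if p1 e = 2 then return_conf (p1 x) K
     else if p1 e = 3 then return_conf (p2 x) K
     else if p1 e = 4 then return_conf 0 K
     else if p1 e = 5 then eval_conf (p1 (p2 e)) x (frame 1 (p2 (p2 e)) x 0 K)
     else if p1 e = 6 then eval_conf (p2 (p2 e)) x (frame 3 (p1 (p2 e)) 0 0 K)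
     else if p1 e = 7 then eval_conf (p1 (p2 e)) (p1 x) (frame 4 (p2 (p2 e)) x 0 K)
     else eval_conf (p1 (p2 e)) (pr x 0) (frame 5 (p1 (p2 e)) x 0 K))"

definition return_step :: "nat \<Rightarrow> nat \<Rightarrow> nat \<Rightarrow> nat \<Rightarrow> nat \<Rightarrow> nat \<Rightarrow> nat" where
  "return_step v t a b c K =
    (if t = 1 then eval_conf a b (frame 2 v 0 0 K)
     else if t = 2 then return_conf (pr a v) K
     else if t = 3 then eval_conf a v K
     else if t = 4 then
       (if c = p2 b then return_conf v K
        else eval_conf a (pr (p1 b) (pr c v)) (frame 4 a b (Suc c) K))
     else
       (if v = 0 then return_conf c K
        else eval_conf a (pr b (Suc c)) (frame 5 a b (Suc c) K)))"

text \<open>A value handed to the empty stack 0 is a fixed point, so a finished computation stays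
  finished under further steps.\<close>

definition step :: "nat \<Rightarrow> nat" where
  "step z =
    (if p1 z = 2 then eval_step (p1 (p2 z)) (p1 (p2 (p2 z))) (p2 (p2 (p2 z)))
     else if p2 (p2 (p2 z)) = 0 then z
     else return_step (p1 (p2 (p2 z))) (p1 (p2 (p2 (p2 z)))) (p1 (p2 (p2 (p2 (p2 z)))))
       (p1 (p2 (p2 (p2 (p2 (p2 z)))))) (p1 (p2 (p2 (p2 (p2 (p2 (p2 z)))))))
       (p2 (p2 (p2 (p2 (p2 (p2 (p2 z))))))))"

lemma computable_step: "computable_fun step"
proof -
  have "computable_fun (\<lambda>z. step z)"
    unfolding step_def eval_step_def return_step_def by (intro computable_intros)
  then show ?thesis .
qed

lemma pr_eq_0_iff: "pr a b = 0 \<longleftrightarrow> a = 0 \<and> b = 0"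
  using prod_encode_eq[of "(a, b)" "(0, 0)"] by (simp add: prod_encode_def)

lemma step_eval [simp]: "step (eval_conf e x K) = eval_step e x K"
  by (simp add: step_def)

lemma step_return [simp]:
  "0 < t \<Longrightarrow> step (return_conf v (frame t a b c K)) = return_step v t a b c K"
  by (simp add: step_def pr_eq_0_iff)

lemma step_halted: "step (return_conf v 0) = return_conf v 0"
  by (simp add: step_def)

lemma funpow_fixed: "f x = x \<Longrightarrow> (f ^^ n) x = x"
  by (induction n) auto

section \<open>Correctness of the simulation\<close>

definition reaches :: "nat \<Rightarrow> nat \<Rightarrow> bool" where
  "reaches c d \<longleftrightarrow> (\<exists>n. (step ^^ n) c = d)"

lemma reaches_refl: "reaches c c"
  unfolding reaches_def by (metis funpow_0)

lemma reaches_trans: "reaches c d \<Longrightarrow> reaches d e \<Longrightarrow> reaches c e"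
  unfolding reaches_def by (metis comp_apply funpow_add)

lemma reaches_step: "reaches (step c) d \<Longrightarrow> reaches c d"
  unfolding reaches_def by (metis comp_apply funpow_Suc_right)

text \<open>Completeness, by induction on the program. The stack \<open>K\<close> is arbitrary
  because subprograms run on top of further frames. Queries are answered by 0, in accordance with
  the empty oracle.\<close>

lemma reaches_run:
  "run {} p x = Some v \<Longrightarrow> reaches (eval_conf (machine_code p) x K) (return_conf v K)"
proof (induction p arbitrary: x v K)
  case (Pair_m p q)
  then obtain a b where ab: "run {} p x = Some a" "run {} q x = Some b" "v = pr a b"
    by (auto simp: bind_eq_Some_conv)
  show ?case
    apply (rule reaches_step)
    apply (simp add: eval_step_def)
    apply (rule reaches_trans[OF Pair_m.IH(1)[OF ab(1)]])
    apply (rule reaches_step)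
    apply (simp add: return_step_def)
    apply (rule reaches_trans[OF Pair_m.IH(2)[OF ab(2)]])
    apply (rule reaches_step)
    apply (simp add: return_step_def ab reaches_refl)
    done
next
  case (Comp_m p q)
  then obtain a where a: "run {} q x = Some a" "run {} p a = Some v"
    by (auto simp: bind_eq_Some_conv)
  show ?case
    apply (rule reaches_step)
    apply (simp add: eval_step_def)
    apply (rule reaches_trans[OF Comp_m.IH(2)[OF a(1)]])
    apply (rule reaches_step)
    apply (simp add: return_step_def)
    apply (rule Comp_m.IH(1)[OF a(2)])
    done
next
  case (Rec_m p q)
  define r where "r = rec_nat (run {} p (p1 x))
      (\<lambda>m r. Option.bind r (\<lambda>v. run {} q (pr (p1 x) (pr m v))))"
  \<comment> \<open>Loop invariant: \<open>r m\<close> is about to be returned to the frame with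
    counter \<open>m\<close>. All these values exist, since an undefined one would make
    \<open>r (p2 x)\<close> undefined too.\<close>
  have loop: "\<exists>u. r m = Some u \<and> reaches (eval_conf (machine_code (Rec_m p q)) x K)
      (return_conf u (frame 4 (machine_code q) x m K))" if "m \<le> p2 x" for m
    using that
  proof (induction m)
    case 0
    have "r 0 \<noteq> None"
    proof
      assume "r 0 = None"
      then have "r m = None" for m by (induction m) (auto simp: r_def)
      with Rec_m.prems show False by (simp add: r_def)
    qed
    then obtain u where u: "run {} p (p1 x) = Some u" by (auto simp: r_def)
    have "reaches (eval_conf (machine_code (Rec_m p q)) x K)
        (return_conf u (frame 4 (machine_code q) x 0 K))"
      by (rule reaches_step) (simp add: eval_step_def Rec_m.IH(1)[OF u])
    with u show ?case by (simp add: r_def)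
  next
    case (Suc m)
    then obtain u where u: "r m = Some u" "reaches (eval_conf (machine_code (Rec_m p q)) x K)
      (return_conf u (frame 4 (machine_code q) x m K))" by auto
    have "r (Suc m) \<noteq> None"
    proof
      assume "r (Suc m) = None"
      then have "r (Suc m + i) = None" for i by (induction i) (auto simp: r_def)
      from this[of "p2 x - Suc m"] Suc.prems Rec_m.prems show False by (simp add: r_def)
    qed
    then obtain u' where u': "run {} q (pr (p1 x) (pr m u)) = Some u'" "r (Suc m) = Some u'"
      using u(1) by (auto simp: r_def)
    have "reaches (return_conf u (frame 4 (machine_code q) x m K))
        (return_conf u' (frame 4 (machine_code q) x (Suc m) K))"
      using Suc.prems
      by (intro reaches_step[of "return_conf u (frame 4 (machine_code q) x m K)"])
        (simp add: return_step_def Rec_m.IH(2)[OF u'(1)])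
    with u(2) u'(2) show ?case by (auto intro: reaches_trans)
  qed
  from loop[of "p2 x"] Rec_m.prems have
    "reaches (eval_conf (machine_code (Rec_m p q)) x K)
      (return_conf v (frame 4 (machine_code q) x (p2 x) K))" by (auto simp: r_def)
  then show ?case
    by (rule reaches_trans) (rule reaches_step, simp add: return_step_def reaches_refl)
next
  case (Mu_m p)
  from Mu_m.prems obtain n where n: "run {} p (pr x n) = Some 0" "\<forall>m<n. run {} p (pr x m) \<noteq> None"
    and v: "v = (LEAST n. run {} p (pr x n) = Some 0)" by (auto split: if_splits)
  from n(1) have v0: "run {} p (pr x v) = Some 0" unfolding v by (rule LeastI)
  from n(1) have "v \<le> n" unfolding v by (rule Least_le)
  have before: "\<exists>u. run {} p (pr x m) = Some u \<and> 0 < u" if "m < v" for m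
  proof -
    from n(2) \<open>v \<le> n\<close> that have "run {} p (pr x m) \<noteq> None" by simp
    moreover from that have "run {} p (pr x m) \<noteq> Some 0"
      unfolding v by (rule not_less_Least)
    ultimately show ?thesis by (cases "run {} p (pr x m)") auto
  qed
  \<comment> \<open>Loop invariant: the tests before \<open>m\<close> gave nonzero values and test
    \<open>m\<close> is about to start.\<close>
  have loop: "reaches (eval_conf (machine_code (Mu_m p)) x K)
      (eval_conf (machine_code p) (pr x m) (frame 5 (machine_code p) x m K))" if "m \<le> v" for m
    using that
  proof (induction m)
    case 0
    show ?case by (rule reaches_step) (simp add: eval_step_def reaches_refl)
  next
    case (Suc m)
    then obtain u where u: "run {} p (pr x m) = Some u" "0 < u" using before[of m] by auto
    have "reaches (return_conf u (frame 5 (machine_code p) x m K))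
       (eval_conf (machine_code p) (pr x (Suc m)) (frame 5 (machine_code p) x (Suc m) K))"
      by (rule reaches_step) (use u(2) in \<open>simp add: return_step_def reaches_refl\<close>)
    then have "reaches (eval_conf (machine_code p) (pr x m) (frame 5 (machine_code p) x m K))
       (eval_conf (machine_code p) (pr x (Suc m)) (frame 5 (machine_code p) x (Suc m) K))"
      by (rule reaches_trans[OF Mu_m.IH[OF u(1)]])
    with Suc show ?case by (auto intro: reaches_trans)
  qed
  have "reaches (return_conf 0 (frame 5 (machine_code p) x v K)) (return_conf v K)"
    by (rule reaches_step) (simp add: return_step_def reaches_refl)
  then show ?case
    by (rule reaches_trans[OF reaches_trans[OF loop[OF order_refl] Mu_m.IH[OF v0]]])
qed (rule reaches_step, auto simp: eval_step_def reaches_refl)+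

abbreviation halts_in :: "nat \<Rightarrow> nat \<Rightarrow> nat \<Rightarrow> bool" where
  "halts_in n c w \<equiv> (step ^^ n) c = return_conf w 0"

lemma halts_in_eval:
  assumes "halts_in n (eval_conf e x K) w"
  obtains k where "n = Suc k" "halts_in k (eval_step e x K) w"
  using assms by (cases n) (auto simp: funpow_Suc_right simp del: funpow.simps(2))

lemma halts_in_return:
  assumes "halts_in n (return_conf v (frame t a b c K)) w" "0 < t"
  obtains k where "n = Suc k" "halts_in k (return_step v t a b c K) w"
  using assms
  by (cases n) (auto simp: funpow_Suc_right pr_eq_0_iff simp del: funpow.simps(2))

text \<open>Soundness: a run that halts must first return the value of the current program to
  \<open>K\<close>. The strict decrease \<open>m < n\<close> serves the unbounded search, where the
  induction is on the number of remaining steps.\<close>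

lemma run_if_halts_in:
  "halts_in n (eval_conf (machine_code p) x K) w \<Longrightarrow>
    \<exists>v m. run {} p x = Some v \<and> m < n \<and> halts_in m (return_conf v K) w"
proof (induction p arbitrary: n x K)
  case (Pair_m p q)
  from Pair_m.prems obtain k where k: "n = Suc k" "halts_in k
      (eval_conf (machine_code p) x (frame 1 (machine_code q) x 0 K)) w"
    by (elim halts_in_eval) (simp add: eval_step_def)
  from Pair_m.IH(1)[OF k(2)] obtain a l where l: "run {} p x = Some a" "l < k"
    "halts_in l (return_conf a (frame 1 (machine_code q) x 0 K)) w" by blast
  from l(3) obtain l' where l': "l = Suc l'"
    "halts_in l' (eval_conf (machine_code q) x (frame 2 a 0 0 K)) w"
    by (elim halts_in_return) (simp_all add: return_step_def)
  from Pair_m.IH(2)[OF l'(2)] obtain b m where m: "run {} q x = Some b" "m < l'"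
    "halts_in m (return_conf b (frame 2 a 0 0 K)) w" by blast
  from m(3) obtain m' where "m = Suc m'" "halts_in m' (return_conf (pr a b) K) w"
    by (elim halts_in_return) (simp_all add: return_step_def)
  with k l l' m show ?case by (intro exI[of _ "pr a b"] exI[of _ m']) auto
next
  case (Comp_m p q)
  from Comp_m.prems obtain k where k: "n = Suc k" "halts_in k
      (eval_conf (machine_code q) x (frame 3 (machine_code p) 0 0 K)) w"
    by (elim halts_in_eval) (simp add: eval_step_def)
  from Comp_m.IH(2)[OF k(2)] obtain a l where l: "run {} q x = Some a" "l < k"
    "halts_in l (return_conf a (frame 3 (machine_code p) 0 0 K)) w" by blast
  from l(3) obtain l' where l': "l = Suc l'" "halts_in l' (eval_conf (machine_code p) a K) w"
    by (elim halts_in_return) (simp_all add: return_step_def)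
  from Comp_m.IH(1)[OF l'(2)] obtain b m where m: "run {} p a = Some b" "m < l'"
    "halts_in m (return_conf b K) w" by blast
  with k l l' m show ?case by (intro exI[of _ b] exI[of _ m]) auto
next
  case (Rec_m p q)
  define r where "r = rec_nat (run {} p (p1 x))
      (\<lambda>m r. Option.bind r (\<lambda>v. run {} q (pr (p1 x) (pr m v))))"
  have loop: "\<exists>u m. r (p2 x) = Some u \<and> m < l \<and> halts_in m (return_conf u K) w"
    if "r c = Some v" "c \<le> p2 x"
      "halts_in l (return_conf v (frame 4 (machine_code q) x c K)) w" for c v l
    using that
  proof (induction "p2 x - c" arbitrary: c v l)
    case 0
    then have c: "c = p2 x" by simp
    from 0 obtain l' where "l = Suc l'" "halts_in l' (return_conf v K) w"
      unfolding c by (elim halts_in_return) (simp_all add: return_step_def)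
    with 0 c show ?case by auto
  next
    case (Suc d)
    then have c: "c < p2 x" by simp
    from Suc.prems(3) c obtain l' where l': "l = Suc l'" "halts_in l'
        (eval_conf (machine_code q) (pr (p1 x) (pr c v)) (frame 4 (machine_code q) x (Suc c) K)) w"
      by (elim halts_in_return) (simp_all add: return_step_def)
    from Rec_m.IH(2)[OF l'(2)] obtain u m where u: "run {} q (pr (p1 x) (pr c v)) = Some u" "m < l'"
      "halts_in m (return_conf u (frame 4 (machine_code q) x (Suc c) K)) w" by blast
    have "\<exists>u' m'. r (p2 x) = Some u' \<and> m' < m \<and> halts_in m' (return_conf u' K) w"
      by (rule Suc.hyps(1)[OF _ _ _ u(3)]) (use Suc c u in \<open>auto simp: r_def\<close>)
    then obtain u' m' where "r (p2 x) = Some u'" "m' < m" "halts_in m' (return_conf u' K) w"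
      by blast
    then show ?case using u l' by (intro exI[of _ u'] exI[of _ m']) auto
  qed
  from Rec_m.prems obtain k where k: "n = Suc k" "halts_in k
      (eval_conf (machine_code p) (p1 x) (frame 4 (machine_code q) x 0 K)) w"
    by (elim halts_in_eval) (simp add: eval_step_def)
  from Rec_m.IH(1)[OF k(2)] obtain a l where l: "run {} p (p1 x) = Some a" "l < k"
    "halts_in l (return_conf a (frame 4 (machine_code q) x 0 K)) w" by blast
  have "\<exists>u m. r (p2 x) = Some u \<and> m < l \<and> halts_in m (return_conf u K) w"
    by (rule loop[OF _ _ l(3)]) (auto simp: r_def l)
  then obtain u m where "r (p2 x) = Some u" "m < l" "halts_in m (return_conf u K) w" by blast
  then show ?case using k l by (intro exI[of _ u] exI[of _ m]) (auto simp: r_def)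
next
  case (Mu_m p)
  have loop: "\<exists>v m. run {} (Mu_m p) x = Some v \<and> m < l \<and> halts_in m (return_conf v K) w"
    if "\<And>j. j < c \<Longrightarrow> \<exists>u. run {} p (pr x j) = Some u \<and> 0 < u"
      "halts_in l (eval_conf (machine_code p) (pr x c) (frame 5 (machine_code p) x c K)) w" for c l
    using that
  proof (induction l arbitrary: c rule: less_induct)
    case (less l)
    from Mu_m.IH[OF less.prems(2)] obtain u m where u: "run {} p (pr x c) = Some u" "m < l"
      "halts_in m (return_conf u (frame 5 (machine_code p) x c K)) w" by blast
    show ?case
    proof (cases "u = 0")
      case True
      with u(3) obtain m' where m': "m = Suc m'" "halts_in m' (return_conf c K) w"
        by (elim halts_in_return) (simp_all add: return_step_def)
      have "(LEAST n. run {} p (pr x n) = Some 0) = c"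
      proof (rule Least_equality)
        show "run {} p (pr x c) = Some 0" using u True by simp
        show "c \<le> y" if "run {} p (pr x y) = Some 0" for y
          using less.prems(1)[of y] that by (cases "y < c") auto
      qed
      moreover have "\<exists>n. run {} p (pr x n) = Some 0 \<and> (\<forall>m<n. run {} p (pr x m) \<noteq> None)"
        using u True less.prems(1) by (intro exI[of _ c]) fastforce
      ultimately have "run {} (Mu_m p) x = Some c" by simp
      with m' u show ?thesis by (intro exI[of _ c] exI[of _ m']) auto
    next
      case False
      with u(3) obtain m' where m': "m = Suc m'" "halts_in m'
          (eval_conf (machine_code p) (pr x (Suc c)) (frame 5 (machine_code p) x (Suc c) K)) w"
        by (elim halts_in_return) (simp_all add: return_step_def)
      have "\<exists>v m. run {} (Mu_m p) x = Some v \<and> m < m' \<and> halts_in m (return_conf v K) w"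
        by (rule less.IH[OF _ _ m'(2)])
          (use u m' False less.prems(1) in \<open>auto simp: less_Suc_eq\<close>)
      with u m' show ?thesis by (metis Suc_lessD less_trans)
    qed
  qed
  from Mu_m.prems obtain k where k: "n = Suc k" "halts_in k
      (eval_conf (machine_code p) (pr x 0) (frame 5 (machine_code p) x 0 K)) w"
    by (elim halts_in_eval) (simp add: eval_step_def)
  from loop[OF _ k(2)] show ?case using k(1) by (metis less_SucI less_nat_zero_code)
qed (erule halts_in_eval, auto simp: eval_step_def)+

lemma halts_in_iff_run:
  "(\<exists>n. halts_in n (eval_conf (machine_code p) x 0) w) \<longleftrightarrow> run {} p x = Some w"
proof
  assume "\<exists>n. halts_in n (eval_conf (machine_code p) x 0) w"
  then obtain v m where "run {} p x = Some v" "halts_in m (return_conf v 0) w"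
    using run_if_halts_in by blast
  then show "run {} p x = Some w"
    using funpow_fixed[of step, OF step_halted] by simp
qed (use reaches_run in \<open>auto simp: reaches_def\<close>)

lemma halts_in_mono:
  assumes "halts_in m c w" "m \<le> n"
  shows "halts_in n c w"
proof -
  from assms(2) obtain k where "n = k + m" by (metis add.commute le_Suc_ex)
  with assms(1) show ?thesis by (simp add: funpow_add funpow_fixed[of step, OF step_halted])
qed

section \<open>Left c.e. reals as limits of increasing strings\<close>

text \<open>A binary string \<open>\<sigma>\<close> is represented by the number with binary expansion \<open>1\<sigma>\<close>. Taking prefixes is
  then division by powers of two, and strings of equal length are ordered lexicographically.\<close>

primrec path_code :: "nat set \<Rightarrow> nat \<Rightarrow> nat" where
  "path_code A 0 = 1"
| "path_code A (Suc k) = 2 * path_code A k + of_bool (k \<in> A)"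

lemma path_code_ge: "2 ^ k \<le> path_code A k"
  by (induction k) auto

lemma path_code_pos: "0 < path_code A k"
  by (rule less_le_trans[OF _ path_code_ge]) simp

lemma path_code_less: "path_code A k < 2 ^ Suc k"
  by (induction k) auto

lemma path_code_div: "path_code A (k + i) div 2 ^ i = path_code A k"
proof (induction i)
  case (Suc i)
  have "path_code A (k + Suc i) div 2 ^ Suc i = path_code A (k + Suc i) div 2 div 2 ^ i"
    by (simp add: div_mult2_eq)
  with Suc show ?case by simp
qed simp

lemma path_code_cong: "(\<And>i. i < n \<Longrightarrow> i \<in> A \<longleftrightarrow> i \<in> B) \<Longrightarrow> path_code A n = path_code B n"
  by (induction n) auto

section \<open>Passing between the two codings of binary strings\<close>

definition string_num :: "bool list \<Rightarrow> nat" where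
  "string_num \<sigma> = foldl (\<lambda>v b. 2 * v + of_bool b) 1 \<sigma>"

lemma string_num_simps [simp]:
  "string_num [] = 1" "string_num (\<sigma> @ [b]) = 2 * string_num \<sigma> + of_bool b"
  by (simp_all add: string_num_def)

lemma string_num_path: "string_num (map (\<lambda>i. i \<in> X) [0..<n]) = path_code X n"
  by (induction n) simp_all

lemma string_num_bounds:
  "2 ^ length \<sigma> \<le> string_num \<sigma> \<and> string_num \<sigma> < 2 ^ Suc (length \<sigma>)"
  by (induction \<sigma> rule: rev_induct) auto

lemma string_num_surj: "2 ^ L \<le> c \<Longrightarrow> c < 2 ^ Suc L \<Longrightarrow> \<exists>\<sigma>. length \<sigma> = L \<and> string_num \<sigma> = c"
proof (induction L arbitrary: c)
  case 0
  then show ?case by (intro exI[of _ "[]"]) auto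
next
  case (Suc L)
  from Suc.prems have "2 ^ L \<le> c div 2" "c div 2 < 2 ^ Suc L"
    by (auto simp: less_eq_div_iff_mult_less_eq div_less_iff_less_mult)
  from Suc.IH[OF this] obtain \<sigma> where "length \<sigma> = L" "string_num \<sigma> = c div 2"
    by blast
  then show ?case by (intro exI[of _ "\<sigma> @ [odd c]"]) (auto simp: of_bool_odd_eq_mod_2)
qed

text \<open>One step of the translation into \<open>string_code\<close>: the last bit of the number
  moves to the front of the list, \<open>Suc (pr x y)\<close> being the \<open>list_encode\<close>
  of a nonempty list.\<close>

definition push_bit :: "nat \<Rightarrow> nat" where
  "push_bit z = pr (p1 z div 2) (Suc (pr (p1 z mod 2) (p2 z)))"

lemma computable_push_bit: "computable_fun push_bit"
proof -
  have "computable_fun (\<lambda>z. push_bit z)"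
    unfolding push_bit_def by (intro computable_intros)
  then show ?thesis .
qed

lemma push_bit_funpow:
  "(push_bit ^^ length \<sigma>) (pr (string_num \<sigma>) (list_encode ys)) =
    pr 1 (list_encode (map of_bool \<sigma> @ ys))"
proof (induction \<sigma> arbitrary: ys rule: rev_induct)
  case (snoc b \<sigma>)
  have "push_bit (pr (string_num (\<sigma> @ [b])) (list_encode ys)) =
      pr (string_num \<sigma>) (list_encode (of_bool b # ys))"
    by (cases b) (simp_all add: push_bit_def)
  with snoc[of "of_bool b # ys"] show ?case
    by (simp add: funpow_Suc_right del: funpow.simps(2) list_encode.simps)
qed simp

lemma length_le_list_encode: "length xs \<le> list_encode xs"
proof (induction xs)
  case (Cons x xs)
  then show ?case using le_prod_encode_2[of "list_encode xs" x] by simp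
qed simp

text \<open>Makes the strings above \<open>N\<close> a decidable set when \<open>N\<close> is
  computable: a string is no longer than its code, so both searches are bounded.\<close>

lemma string_code_image_iff:
  "x \<in> string_code ` {\<sigma>. N (length \<sigma>) \<le> string_num \<sigma>} \<longleftrightarrow>
    (\<exists>L<Suc x. \<exists>c<2 ^ Suc L. 2 ^ L \<le> c \<and> N L \<le> c \<and> (push_bit ^^ L) (pr c 0) = pr 1 x)"
proof
  assume "x \<in> string_code ` {\<sigma>. N (length \<sigma>) \<le> string_num \<sigma>}"
  then obtain \<sigma> where \<sigma>: "x = string_code \<sigma>" "N (length \<sigma>) \<le> string_num \<sigma>" by blast
  moreover have "length \<sigma> \<le> x"
    using length_le_list_encode[of "map of_bool \<sigma>"] \<sigma>(1) by (simp add: string_code_def)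
  ultimately show "\<exists>L<Suc x. \<exists>c<2 ^ Suc L. 2 ^ L \<le> c \<and> N L \<le> c \<and> (push_bit ^^ L) (pr c 0) = pr 1 x"
    using push_bit_funpow[of \<sigma> "[]"] string_num_bounds[of \<sigma>]
    by (intro exI[of _ "length \<sigma>"] conjI exI[of _ "string_num \<sigma>"]) (auto simp: string_code_def)
next
  assume "\<exists>L<Suc x. \<exists>c<2 ^ Suc L. 2 ^ L \<le> c \<and> N L \<le> c \<and> (push_bit ^^ L) (pr c 0) = pr 1 x"
  then obtain L c where Lc: "2 ^ L \<le> c" "c < 2 ^ Suc L" "N L \<le> c"
    "(push_bit ^^ L) (pr c 0) = pr 1 x" by blast
  from string_num_surj[OF this(1,2)] obtain \<sigma> where "length \<sigma> = L" "string_num \<sigma> = c" by blast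
  with Lc push_bit_funpow[of \<sigma> "[]"] show "x \<in> string_code ` {\<sigma>. N (length \<sigma>) \<le> string_num \<sigma>}"
    by (auto simp: string_code_def)
qed

text \<open>\<open>N s\<close> codes a string of length \<open>s\<close>. The last condition says
  that \<open>N (Suc s)\<close> without its last bit is at least \<open>N s\<close>: the
  approximation only moves to the right.\<close>

locale increasing_strings =
  fixes N :: "nat \<Rightarrow> nat"
  assumes ge: "2 ^ s \<le> N s"
    and less: "N s < 2 ^ Suc s"
    and double_le: "2 * N s \<le> N (Suc s)"
begin

lemma prefix_mono:
  assumes "k \<le> s" "s \<le> t"
  shows "N s div 2 ^ (s - k) \<le> N t div 2 ^ (t - k)"
  using assms(2)
proof (induction t rule: dec_induct)
  case (step t)
  note step.IH
  also have "N t div 2 ^ (t - k) \<le> N (Suc t) div 2 div 2 ^ (t - k)"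
    using double_le[of t] by (intro div_le_mono) simp
  also have "\<dots> = N (Suc t) div 2 ^ Suc (t - k)"
    by (simp only: power_Suc div_mult2_eq)
  also have "Suc (t - k) = Suc t - k"
    using step.hyps assms(1) by simp
  finally show ?case .
qed simp

lemma prefix_less:
  assumes "k \<le> s"
  shows "N s div 2 ^ (s - k) < 2 ^ Suc k"
proof (rule less_mult_imp_div_less)
  have eq: "(2::nat) ^ Suc s = 2 ^ Suc k * 2 ^ (s - k)"
    unfolding power_add[symmetric] using assms by simp
  from less[of s] show "N s < 2 ^ Suc k * 2 ^ (s - k)" unfolding eq .
qed

text \<open>The prefixes of length \<open>k\<close> increase and take only finitely many values, so
  they settle at their maximum. The clause \<open>k \<le> s\<close> keeps \<open>s - k\<close> a
  genuine difference.\<close>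

lemma prefix_converges: "\<exists>c s0. \<forall>s\<ge>s0. k \<le> s \<and> N s div 2 ^ (s - k) = c"
proof -
  have fin: "finite ((\<lambda>s. N s div 2 ^ (s - k)) ` {k..})"
    by (rule finite_subset[of _ "{..<2 ^ Suc k}"]) (use prefix_less in auto)
  define c where "c = Max ((\<lambda>s. N s div 2 ^ (s - k)) ` {k..})"
  have "c \<in> (\<lambda>s. N s div 2 ^ (s - k)) ` {k..}"
    unfolding c_def by (rule Max_in[OF fin]) auto
  then obtain s0 where s0: "k \<le> s0" "c = N s0 div 2 ^ (s0 - k)" by auto
  have "N s div 2 ^ (s - k) = c" if "s0 \<le> s" for s
  proof (rule antisym)
    show "N s div 2 ^ (s - k) \<le> c"
      unfolding c_def by (rule Max_ge[OF fin]) (use s0(1) that in simp)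
    show "c \<le> N s div 2 ^ (s - k)"
      using prefix_mono[of k s0 s] s0 that by simp
  qed
  with s0(1) show ?thesis by (intro exI[of _ c] exI[of _ s0]) auto
qed

lemma limit_exists: "\<exists>X. \<forall>k. \<exists>s0. \<forall>s\<ge>s0. k \<le> s \<and> N s div 2 ^ (s - k) = path_code X k"
proof -
  define c where "c k = (SOME c. \<exists>s0. \<forall>s\<ge>s0. k \<le> s \<and> N s div 2 ^ (s - k) = c)" for k
  have c: "\<exists>s0. \<forall>s\<ge>s0. k \<le> s \<and> N s div 2 ^ (s - k) = c k" for k
    unfolding c_def by (rule someI_ex[OF prefix_converges])
  \<comment> \<open>Bit \<open>j\<close> of the limit is the last bit of the stable prefix of length
    \<open>Suc j\<close>.\<close>
  define X where "X = {j. odd (c (Suc j))}"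
  have "c k = path_code X k" for k
  proof (induction k)
    case 0
    from c[of 0] obtain s where s: "N s div 2 ^ s = c 0" by auto
    have "N s div 2 ^ s = 1"
      using ge[of s] less[of s] by (intro div_nat_eqI) auto
    with s show ?case by simp
  next
    case (Suc k)
    from c[of k] obtain s0 where s0: "\<And>s. s0 \<le> s \<Longrightarrow> k \<le> s \<and> N s div 2 ^ (s - k) = c k" by blast
    from c[of "Suc k"] obtain s1 where
      s1: "\<And>s. s1 \<le> s \<Longrightarrow> Suc k \<le> s \<and> N s div 2 ^ (s - Suc k) = c (Suc k)" by blast
    define s where "s = max s0 s1"
    then have "Suc k \<le> s" using s1[of s] by simp
    have "c (Suc k) div 2 = N s div 2 ^ (s - Suc k) div 2" using s1[of s] by (simp add: s_def)
    also have "\<dots> = N s div 2 ^ Suc (s - Suc k)" by (simp only: power_Suc2 div_mult2_eq)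
    also have "Suc (s - Suc k) = s - k" using \<open>Suc k \<le> s\<close> by simp
    also have "N s div 2 ^ (s - k) = c k" using s0[of s] by (simp add: s_def)
    finally have "c (Suc k) = 2 * path_code X k + c (Suc k) mod 2"
      using Suc mult_div_mod_eq[of 2 "c (Suc k)"] by linarith
    moreover have "of_bool (k \<in> X) = c (Suc k) mod 2"
      by (simp add: X_def of_bool_odd_eq_mod_2)
    ultimately show ?case unfolding path_code.simps by linarith
  qed
  then have "c = path_code X" by (rule ext)
  with c show ?thesis by auto
qed

text \<open>The strings that are lexicographically at least \<open>N\<close> form a tree whose leftmost path
  is the limit of \<open>N\<close>.\<close>

lemma left_ce_limit:
  assumes "computable_fun N"
    and lim: "\<And>k. \<exists>s0. \<forall>s\<ge>s0. k \<le> s \<and> N s div 2 ^ (s - k) = path_code X k"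
  shows "left_ce X"
proof -
  define T where "T = {\<sigma>. N (length \<sigma>) \<le> string_num \<sigma>}"
  have butlast: "\<sigma> \<in> T" if "\<sigma> @ [b] \<in> T" for \<sigma> b
    using that double_le[of "length \<sigma>"] by (cases b) (auto simp: T_def)
  have "\<sigma> \<in> T" if "\<sigma> @ \<tau> \<in> T" for \<sigma> \<tau>
    using that
  proof (induction \<tau> rule: rev_induct)
    case (snoc b \<tau>)
    then show ?case using butlast[of "\<sigma> @ \<tau>" b] by simp
  qed simp
  then have "is_tree T" by (auto simp: is_tree_def prefix_def)
  moreover have "decidable (\<lambda>x. x \<in> string_code ` T)"
    unfolding T_def string_code_image_iff
    by (intro computable_intros computable_funpow computable_push_bit computable_comp[OF assms(1)])
  ultimately have tree: "computable_tree T"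
    by (simp add: computable_tree_def computable_set_iff_decidable)
  have path_iff: "is_path Y T \<longleftrightarrow> (\<forall>k. N k \<le> path_code Y k)" for Y
    by (simp add: is_path_def T_def string_num_path)
  have "N k \<le> path_code X k" for k
  proof -
    from lim[of k] obtain s where "k \<le> s" "N s div 2 ^ (s - k) = path_code X k" by blast
    with prefix_mono[of k k s] show ?thesis by simp
  qed
  moreover have "less_fun (\<lambda>i. i \<in> X) (\<lambda>i. i \<in> Y)"
    if Y: "\<forall>k. N k \<le> path_code Y k" and "Y \<noteq> X" for Y
  proof -
    from \<open>Y \<noteq> X\<close> have ex: "\<exists>j. (j \<in> X) \<noteq> (j \<in> Y)" by blast
    define j where "j = (LEAST j. (j \<in> X) \<noteq> (j \<in> Y))"
    have j: "(j \<in> X) \<noteq> (j \<in> Y)" unfolding j_def by (rule LeastI_ex[OF ex])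
    have agree: "(i \<in> X) = (i \<in> Y)" if "i < j" for i
      using not_less_Least[of i "\<lambda>j. (j \<in> X) \<noteq> (j \<in> Y)"] that unfolding j_def by blast
    have "j \<notin> X"
    proof
      assume "j \<in> X"
      with j have "j \<notin> Y" by simp
      from lim[of "Suc j"] obtain s where
        s: "Suc j \<le> s" "N s div 2 ^ (s - Suc j) = path_code X (Suc j)" by blast
      \<comment> \<open>At stage \<open>s\<close> the approximation agrees with \<open>X\<close> on
        the first \<open>Suc j\<close> bits and is at most the prefix of \<open>Y\<close>, so there
        \<open>X\<close> cannot exceed \<open>Y\<close>.\<close>
      have "path_code X (Suc j) \<le> path_code Y s div 2 ^ (s - Suc j)"
        unfolding s(2)[symmetric] using Y by (intro div_le_mono) auto
      also have "\<dots> = path_code Y (Suc j)"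
        using path_code_div[of Y "Suc j" "s - Suc j"] s(1) by simp
      finally show False
        using path_code_cong[of j X Y] agree \<open>j \<in> X\<close> \<open>j \<notin> Y\<close> by simp
    qed
    with j have "j \<in> Y" by simp
    with \<open>j \<notin> X\<close> agree show ?thesis
      unfolding less_fun_def by (intro exI[of _ j]) auto
  qed
  ultimately have "leftmost_path X T"
    unfolding leftmost_path_def path_iff by blast
  with tree show ?thesis by (auto simp: left_ce_def)
qed

end

section \<open>Assigning strings to stages\<close>

text \<open>Iterated halving of \<open>u\<close> runs through the codes of its prefixes and then
  stays at 0, which \<open>0 < t\<close> excludes. The bound \<open>i < u\<close> makes the relation
  decidable and loses no prefix.\<close>

definition prefix_code :: "nat \<Rightarrow> nat \<Rightarrow> bool" where
  "prefix_code t u \<longleftrightarrow> 0 < t \<and> (\<exists>i<u. u div 2 ^ i = t)"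

lemma prefix_codeI:
  assumes "0 < u div 2 ^ i"
  shows "prefix_code (u div 2 ^ i) u"
proof -
  from assms have "2 ^ i \<le> u" by (simp add: div_greater_zero_iff)
  with less_exp[of i] have "i < u" by linarith
  with assms show ?thesis unfolding prefix_code_def by blast
qed

lemma prefix_code_refl: "0 < u \<Longrightarrow> prefix_code u u"
  using prefix_codeI[of u 0] by simp

lemma prefix_code_div:
  assumes "prefix_code t (u div 2 ^ i)"
  shows "prefix_code t u"
proof -
  from assms obtain j where "0 < t" "u div 2 ^ i div 2 ^ j = t"
    by (auto simp: prefix_code_def)
  then show ?thesis using prefix_codeI[of u "i + j"] by (simp add: power_add div_mult2_eq)
qed

lemma prefix_code_le: "prefix_code t u \<Longrightarrow> t \<le> u"
  by (auto simp: prefix_code_def)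

lemma prefix_code_path_code:
  assumes "prefix_code t (path_code A k)"
  obtains j where "j \<le> k" "t = path_code A j"
proof -
  from assms obtain i where i: "0 < t" "path_code A k div 2 ^ i = t"
    by (auto simp: prefix_code_def)
  have "i \<le> k"
  proof (rule ccontr)
    assume "\<not> i \<le> k"
    then have "(2::nat) ^ Suc k \<le> 2 ^ i" by (intro power_increasing) auto
    with path_code_less[of A k] i show False by simp
  qed
  then have "t = path_code A (k - i)" using i(2) path_code_div[of A "k - i" i] by simp
  then show thesis by (intro that[of "k - i"]) auto
qed

lemma path_code_eq_length:
  assumes "path_code A i = path_code B j"
  shows "i = j"
proof -
  have "(2::nat) ^ i < 2 ^ Suc j" "(2::nat) ^ j < 2 ^ Suc i"
    using path_code_ge[of i A] path_code_less[of A i] path_code_ge[of j B] path_code_less[of B j] assms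
    by linarith+
  then have "i < Suc j" "j < Suc i" by (simp_all only: power_strict_increasing_iff one_less_numeral_iff semiring_norm)
  then show ?thesis by simp
qed

definition item :: "nat \<Rightarrow> nat \<Rightarrow> nat" where
  "item h i = p1 ((p2 ^^ i) h)"

text \<open>The history \<open>h\<close> of a stage \<open>s\<close> lists the targets of the earlier stages, the latest one first;
  \<open>H r s\<close> says that by stage \<open>s\<close> the string assigned at stage \<open>r\<close> has been excluded. The disjunct
  \<open>2 ^ Suc s \<le> Suc u\<close> makes \<open>leftmost\<close> fall back to the string \<open>11\<dots>1\<close> when all strings of length
  \<open>s\<close> are excluded.\<close>

definition leftmost :: "(nat \<Rightarrow> nat \<Rightarrow> bool) \<Rightarrow> nat \<Rightarrow> nat \<Rightarrow> nat" where
  "leftmost H s h = (LEAST u. 2 ^ s \<le> u \<and>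
    (2 ^ Suc s \<le> Suc u \<or> (\<forall>i<s. H (s - Suc i) s \<longrightarrow> \<not> prefix_code (item h i) u)))"

text \<open>Codes of prefixes of one string grow with their length, so the least such
  \<open>t\<close> is the shortest. The disjunct \<open>t = leftmost H s h\<close> guarantees that
  the minimum exists.\<close>

definition fresh :: "(nat \<Rightarrow> nat \<Rightarrow> bool) \<Rightarrow> nat \<Rightarrow> nat \<Rightarrow> nat" where
  "fresh H s h = (LEAST t. t = leftmost H s h \<or>
    prefix_code t (leftmost H s h) \<and> (\<forall>i<s. item h i \<noteq> t))"

primrec history :: "(nat \<Rightarrow> nat \<Rightarrow> bool) \<Rightarrow> nat \<Rightarrow> nat" where
  "history H 0 = 0"
| "history H (Suc s) = pr (fresh H s (history H s)) (history H s)"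

definition guess :: "(nat \<Rightarrow> nat \<Rightarrow> bool) \<Rightarrow> nat \<Rightarrow> nat" where
  "guess H s = leftmost H s (history H s)"

definition target :: "(nat \<Rightarrow> nat \<Rightarrow> bool) \<Rightarrow> nat \<Rightarrow> nat" where
  "target H s = fresh H s (history H s)"

lemma item_history: "i < s \<Longrightarrow> item (history H s) i = target H (s - Suc i)"
proof (induction s arbitrary: i)
  case (Suc s)
  show ?case
  proof (cases i)
    case 0
    then show ?thesis by (simp add: item_def target_def)
  next
    case (Suc j)
    with Suc.IH[of j] Suc.prems show ?thesis
      by (simp add: item_def funpow_Suc_right del: funpow.simps(2))
  qed
qed simp

lemma all_less_reverse: "(\<forall>i<s. P (s - Suc i)) \<longleftrightarrow> (\<forall>r<s. P r)"
proof safe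
  fix r assume *: "\<forall>i<s. P (s - Suc i)" "r < s"
  then have "s - Suc r < s" "s - Suc (s - Suc r) = r" by simp_all
  with *(1)[rule_format, of "s - Suc r"] show "P r" by simp
qed simp

text \<open>The history turns a course-of-values recursion into a primitive one; this form and
  \<open>target_eq\<close> speak of stages directly.\<close>

lemma guess_eq: "guess H s = (LEAST u. 2 ^ s \<le> u \<and>
    (2 ^ Suc s \<le> Suc u \<or> (\<forall>r<s. H r s \<longrightarrow> \<not> prefix_code (target H r) u)))"
proof -
  have "(\<forall>i<s. H (s - Suc i) s \<longrightarrow> \<not> prefix_code (item (history H s) i) u) \<longleftrightarrow>
      (\<forall>r<s. H r s \<longrightarrow> \<not> prefix_code (target H r) u)" for u
    using all_less_reverse[of s "\<lambda>r. H r s \<longrightarrow> \<not> prefix_code (target H r) u"]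
    by (simp add: item_history)
  then show ?thesis unfolding guess_def leftmost_def by simp
qed

lemma target_eq: "target H s = (LEAST t. t = guess H s \<or>
    prefix_code t (guess H s) \<and> (\<forall>r<s. target H r \<noteq> t))"
proof -
  have "(\<forall>i<s. item (history H s) i \<noteq> t) \<longleftrightarrow> (\<forall>r<s. target H r \<noteq> t)" for t
    using all_less_reverse[of s "\<lambda>r. target H r \<noteq> t"] by (simp add: item_history)
  then show ?thesis by (simp only: target_def fresh_def guess_def)
qed

lemma guess_prop:
  "2 ^ s \<le> guess H s"
  "2 ^ Suc s \<le> Suc (guess H s) \<or> (\<forall>r<s. H r s \<longrightarrow> \<not> prefix_code (target H r) (guess H s))"
proof -
  have "2 ^ s \<le> guess H s \<and>
    (2 ^ Suc s \<le> Suc (guess H s) \<or> (\<forall>r<s. H r s \<longrightarrow> \<not> prefix_code (target H r) (guess H s)))"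
    unfolding guess_eq by (rule LeastI[of _ "2 ^ Suc s"]) simp
  then show "2 ^ s \<le> guess H s"
    "2 ^ Suc s \<le> Suc (guess H s) \<or> (\<forall>r<s. H r s \<longrightarrow> \<not> prefix_code (target H r) (guess H s))"
    by auto
qed

lemma guess_le:
  assumes "2 ^ s \<le> u"
    "2 ^ Suc s \<le> Suc u \<or> (\<forall>r<s. H r s \<longrightarrow> \<not> prefix_code (target H r) u)"
  shows "guess H s \<le> u"
  unfolding guess_eq by (rule Least_le) (use assms in blast)

lemma guess_less: "guess H s < 2 ^ Suc s"
proof -
  \<comment> \<open>The string of \<open>s\<close> ones is always admissible by the fallback
    disjunct.\<close>
  have "guess H s \<le> 2 ^ Suc s - 1" by (rule guess_le) auto
  moreover have "0 < (2::nat) ^ Suc s" by simp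
  ultimately show ?thesis by linarith
qed

lemma guess_pos: "0 < guess H s"
  by (rule less_le_trans[OF _ guess_prop(1)]) simp

lemma target_prefix: "prefix_code (target H s) (guess H s)"
proof -
  have "target H s = guess H s \<or> prefix_code (target H s) (guess H s) \<and> (\<forall>r<s. target H r \<noteq> target H s)"
    unfolding target_eq[of H s] by (rule LeastI[of _ "guess H s"]) simp
  then show ?thesis using prefix_code_refl[OF guess_pos] by auto
qed

lemma target_less: "target H s < 2 ^ Suc s"
  using prefix_code_le[OF target_prefix] guess_less by (rule le_less_trans)

text \<open>A target is either chosen to be new or is the whole guess of its stage \<open>s\<close>,
  which has length \<open>s\<close> and is longer than every earlier target.\<close>

lemma inj_target: "inj (target H)"
proof (rule linorder_injI)
  fix r s :: nat
  assume "r < s"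
  have "target H s = guess H s \<or> prefix_code (target H s) (guess H s) \<and> (\<forall>r<s. target H r \<noteq> target H s)"
    unfolding target_eq[of H s] by (rule LeastI[of _ "guess H s"]) simp
  then show "target H r \<noteq> target H s"
  proof
    assume "target H s = guess H s"
    have "(2::nat) ^ Suc r \<le> 2 ^ s" using \<open>r < s\<close> by (intro power_increasing) auto
    with target_less[of H r] guess_prop(1)[of s H] \<open>target H s = guess H s\<close> show ?thesis by simp
  qed (use \<open>r < s\<close> in blast)
qed

lemma finite_target_less: "finite {s. target H s < n}"
  using finite_vimageI[OF finite_lessThan[of n] inj_target[of H]] by (simp add: vimage_def)

section \<open>Convergence of guesses and targets\<close>

locale monotone_hits =
  fixes H :: "nat \<Rightarrow> nat \<Rightarrow> bool"
  assumes mono: "H r s \<Longrightarrow> s \<le> t \<Longrightarrow> H r t"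
begin

text \<open>Exclusions persist, and a string with an excluded prefix has only excluded extensions.
  So the next guess without its last bit is admissible at stage \<open>s\<close>, unless the next
  guess is all ones and the inequality is trivial.\<close>

sublocale increasing_strings "guess H"
proof
  fix s
  show "2 * guess H s \<le> guess H (Suc s)"
  proof (cases "2 ^ Suc (Suc s) \<le> Suc (guess H (Suc s))")
    case True
    then show ?thesis using guess_less[of H s] by simp
  next
    case False
    then have avoid: "\<not> prefix_code (target H r) (guess H (Suc s))" if "r < Suc s" "H r (Suc s)" for r
      using guess_prop(2)[of "Suc s" H] that by blast
    have "guess H s \<le> guess H (Suc s) div 2 ^ 1"
    proof (rule guess_le)
      show "2 ^ s \<le> guess H (Suc s) div 2 ^ 1"
        using guess_prop(1)[of "Suc s" H] by (simp add: less_eq_div_iff_mult_less_eq)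
      have "\<not> prefix_code (target H r) (guess H (Suc s) div 2 ^ 1)" if "r < s" "H r s" for r
      proof -
        from that mono[OF that(2), of "Suc s"] have "\<not> prefix_code (target H r) (guess H (Suc s))"
          by (intro avoid) simp_all
        then show ?thesis using prefix_code_div by blast
      qed
      then show "2 ^ Suc s \<le> Suc (guess H (Suc s) div 2 ^ 1) \<or>
        (\<forall>r<s. H r s \<longrightarrow> \<not> prefix_code (target H r) (guess H (Suc s) div 2 ^ 1))" by blast
    qed
    then show ?thesis by simp
  qed
qed (rule guess_prop guess_less)+

context
  fixes X
  assumes lim: "\<And>k. \<exists>s0. \<forall>s\<ge>s0. k \<le> s \<and> guess H s div 2 ^ (s - k) = path_code X k"
begin

lemma eventually_prefix_guess: "\<exists>s0. \<forall>s\<ge>s0. prefix_code (path_code X k) (guess H s)"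
proof -
  from lim[of k] obtain s0 where
    s0: "\<And>s. s0 \<le> s \<Longrightarrow> guess H s div 2 ^ (s - k) = path_code X k" by blast
  have "prefix_code (path_code X k) (guess H s)" if "s0 \<le> s" for s
    using prefix_codeI[of "guess H s" "s - k"] path_code_pos[of X k] unfolding s0[OF that] .
  then show ?thesis by blast
qed

text \<open>A never assigned prefix of \<open>X\<close> would be a candidate at almost all stages
  and would bound almost all targets, against injectivity.\<close>

lemma path_code_is_target: "\<exists>r. target H r = path_code X k"
proof (rule ccontr)
  assume *: "\<nexists>r. target H r = path_code X k"
  from eventually_prefix_guess[of k] obtain s0
    where s0: "\<And>s. s0 \<le> s \<Longrightarrow> prefix_code (path_code X k) (guess H s)" by blast
  have "target H s < Suc (path_code X k)" if "s0 \<le> s" for s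
  proof -
    have "target H s \<le> path_code X k"
      unfolding target_eq[of H s] by (rule Least_le) (use * s0[OF that] in auto)
    then show ?thesis by simp
  qed
  then have "{s0..} \<subseteq> {s. target H s < Suc (path_code X k)}" by auto
  then have "finite {s0..}" using finite_target_less by (rule finite_subset)
  then show False using infinite_Ici by blast
qed

text \<open>By injectivity almost all targets have length at least \<open>k\<close>. Being prefixes
  of guesses that extend the first \<open>k\<close> bits of \<open>X\<close>, they extend these bits
  as well.\<close>

lemma eventually_prefix_target: "\<exists>s0. \<forall>s\<ge>s0. prefix_code (path_code X k) (target H s)"
proof -
  from lim[of k] obtain s0 where
    s0: "\<And>s. s0 \<le> s \<Longrightarrow> k \<le> s \<and> guess H s div 2 ^ (s - k) = path_code X k" by blast
  from finite_target_less[of H "2 ^ k"] obtain s1 where "\<forall>s\<in>{s. target H s < 2 ^ k}. s < s1"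
    unfolding finite_nat_set_iff_bounded by blast
  then have s1: "2 ^ k \<le> target H s" if "s1 \<le> s" for s
    using that by (meson leD mem_Collect_eq not_le_imp_less)
  have "prefix_code (path_code X k) (target H s)" if "max s0 s1 \<le> s" for s
  proof -
    from target_prefix[of H s] obtain i where i: "guess H s div 2 ^ i = target H s"
      by (auto simp: prefix_code_def)
    have "i \<le> s - k"
    proof (rule ccontr)
      assume "\<not> i \<le> s - k"
      then have "(2::nat) ^ Suc s \<le> 2 ^ (k + i)" by (intro power_increasing) auto
      with guess_less[of H s] have "guess H s < 2 ^ k * 2 ^ i" unfolding power_add by linarith
      then have "guess H s div 2 ^ i < 2 ^ k" by (rule less_mult_imp_div_less)
      with i s1[of s] that show False by simp
    qed
    then have "i + (s - k - i) = s - k" by simp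
    then have "target H s div 2 ^ (s - k - i) = guess H s div 2 ^ (s - k)"
      unfolding i[symmetric] div_mult2_eq[symmetric] power_add[symmetric] by (simp only:)
    also have "\<dots> = path_code X k" using s0[of s] that by simp
    finally have eq: "target H s div 2 ^ (s - k - i) = path_code X k" .
    show ?thesis
      using prefix_codeI[of "target H s" "s - k - i"] path_code_pos[of X k] unfolding eq .
  qed
  then show ?thesis by blast
qed

text \<open>No block whose string lies on the limit path is ever hit, since a hit would push the
  approximation off that string for good.\<close>

lemma not_hit_if_target_path:
  assumes avoid: "\<And>s r. r < s \<Longrightarrow> H r s \<Longrightarrow> \<not> prefix_code (target H r) (guess H s)"
    and "target H r = path_code X k"
  shows "\<not> H r s"
proof
  assume "H r s"
  from eventually_prefix_guess[of k] obtain s0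
    where s0: "\<And>s. s0 \<le> s \<Longrightarrow> prefix_code (path_code X k) (guess H s)" by blast
  define t where "t = Suc (max s0 (max r s))"
  have "H r t" using mono[OF \<open>H r s\<close>] by (simp add: t_def)
  then have "\<not> prefix_code (target H r) (guess H t)" by (intro avoid) (simp_all add: t_def)
  with s0[of t] assms(2) show False by (simp add: t_def)
qed

lemma infinite_path_targets: "infinite {r. \<exists>k. target H r = path_code X k}"
proof
  assume fin: "finite {r. \<exists>k. target H r = path_code X k}"
  have "range (path_code X) \<subseteq> target H ` {r. \<exists>k. target H r = path_code X k}"
  proof (rule image_subsetI)
    fix k
    obtain r where "target H r = path_code X k" using path_code_is_target by blast
    then show "path_code X k \<in> target H ` {r. \<exists>k. target H r = path_code X k}"
      by (intro image_eqI[of _ _ r]) auto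
  qed
  then have "finite (range (path_code X))" using fin by (meson finite_imageI finite_subset)
  moreover have "inj (path_code X)" by (rule injI) (rule path_code_eq_length)
  ultimately show False using finite_imageD infinite_UNIV_nat by blast
qed

end

end

text \<open>If hits are truthful about \<open>A\<close>, then \<open>A\<close> itself is never excluded, so the fallback string
  is never needed.\<close>

lemma guess_avoids:
  assumes "\<And>r s k. H r s \<Longrightarrow> target H r \<noteq> path_code A k" "r < s" "H r s"
  shows "\<not> prefix_code (target H r) (guess H s)"
proof -
  have A: "\<forall>r<s. H r s \<longrightarrow> \<not> prefix_code (target H r) (path_code A s)"
    using assms(1) by (blast elim: prefix_code_path_code)
  then have le: "guess H s \<le> path_code A s"
    using path_code_ge by (intro guess_le) auto
  show ?thesis
  proof (cases "2 ^ Suc s \<le> Suc (guess H s)")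
    case True
    \<comment> \<open>Here the guess is all ones and at most \<open>path_code A s\<close>, so it is
      the prefix of \<open>A\<close> itself.\<close>
    with le path_code_less[of A s] have "guess H s = path_code A s" by simp
    with A assms show ?thesis by auto
  qed (use guess_prop(2)[of s H] assms in blast)
qed

section \<open>Computability of guesses and targets, with targets uniform in the column\<close>

lemma decidable_prefix_code:
  "computable_fun a \<Longrightarrow> computable_fun b \<Longrightarrow> decidable (\<lambda>x. prefix_code (a x) (b x))"
  by (rule decidable_comp2[where P = prefix_code]) (unfold prefix_code_def, intro computable_intros)

lemma computable_item:
  "computable_fun a \<Longrightarrow> computable_fun b \<Longrightarrow> computable_fun (\<lambda>x. item (a x) (b x))"
  unfolding item_def by (intro computable_p1 computable_funpow computable_p2 computable_id)

context
  fixes H :: "nat \<Rightarrow> nat \<Rightarrow> nat \<Rightarrow> bool"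
  assumes dec: "decidable (\<lambda>z. H (p1 z) (p1 (p2 z)) (p2 (p2 z)))"
begin

lemma decidable_hits:
  "computable_fun a \<Longrightarrow> computable_fun b \<Longrightarrow> computable_fun c \<Longrightarrow> decidable (\<lambda>x. H (a x) (b x) (c x))"
  using dec unfolding decidable_def by (rule computable_comp3)

lemma computable_leftmost:
  assumes "computable_fun a" "computable_fun b" "computable_fun c"
  shows "computable_fun (\<lambda>x. leftmost (H (a x)) (b x) (c x))"
proof (rule computable_comp3[OF _ assms])
  show "computable_fun (\<lambda>z. leftmost (H (p1 z)) (p1 (p2 z)) (p2 (p2 z)))"
    unfolding leftmost_def
  proof (rule computable_Least)
    show "\<exists>u. 2 ^ p1 (p2 x) \<le> u \<and> (2 ^ Suc (p1 (p2 x)) \<le> Suc u \<or> Q u)" for x Q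
      by (intro exI[of _ "2 ^ Suc (p1 (p2 x))"]) simp
  qed (intro computable_intros decidable_hits decidable_prefix_code computable_item)
qed

lemma computable_fresh:
  assumes "computable_fun a" "computable_fun b" "computable_fun c"
  shows "computable_fun (\<lambda>x. fresh (H (a x)) (b x) (c x))"
proof (rule computable_comp3[OF _ assms])
  show "computable_fun (\<lambda>z. fresh (H (p1 z)) (p1 (p2 z)) (p2 (p2 z)))"
    unfolding fresh_def
  proof (rule computable_Least)
    show "\<exists>t. t = u \<or> Q t" for u :: nat and Q by blast
  qed (intro computable_intros computable_leftmost decidable_prefix_code computable_item)
qed

lemma computable_history:
  assumes "computable_fun a" "computable_fun b"
  shows "computable_fun (\<lambda>x. history (H (a x)) (b x))"
proof (rule computable_comp2[OF _ assms])
  have "computable_fun (\<lambda>z. rec_nat 0 (\<lambda>m r. pr (fresh (H (p1 z)) m r) r) (p2 z))"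
    by (intro computable_rec_nat computable_fresh computable_intros)
  moreover have "rec_nat 0 (\<lambda>m r. pr (fresh (H e) m r) r) s = history (H e) s" for e s
    by (induction s) auto
  ultimately show "computable_fun (\<lambda>z. history (H (p1 z)) (p2 z))" by simp
qed

lemma computable_guess: "computable_fun (guess (H e))"
proof -
  have "computable_fun (\<lambda>x. guess (H e) x)"
    unfolding guess_def by (intro computable_leftmost computable_history computable_intros)
  then show ?thesis .
qed

lemma computable_target:
  "computable_fun a \<Longrightarrow> computable_fun b \<Longrightarrow> computable_fun (\<lambda>x. target (H (a x)) (b x))"
  unfolding target_def by (intro computable_fresh computable_history)

end

section \<open>Blocks and density\<close>

text \<open>The numbers with given level and column form a block that has density \<open>2 ^ - (e + 2)\<close> in an initial
  segment of \<open>\<omega>\<close> when its column is \<open>e\<close> and its level is large, while the columns from \<open>m\<close> on have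
  density at most \<open>2 ^ - m\<close> together.\<close>

definition level :: "nat \<Rightarrow> nat" where
  "level x = (LEAST s. x < 2 ^ Suc s)"

text \<open>The 2-adic valuation; the disjunct \<open>x = 0\<close> puts 0 into column 0.\<close>

definition column :: "nat \<Rightarrow> nat" where
  "column x = (LEAST e. x = 0 \<or> \<not> 2 ^ Suc e dvd x)"

lemma level_eqI:
  assumes "2 ^ s \<le> x" "x < 2 ^ Suc s"
  shows "level x = s"
  unfolding level_def
proof (rule Least_equality)
  fix r assume "x < 2 ^ Suc r"
  with assms(1) have "(2::nat) ^ s < 2 ^ Suc r" by linarith
  then show "s \<le> r" by (simp only: power_strict_increasing_iff one_less_numeral_iff semiring_norm less_Suc_eq_le)
qed (rule assms)

lemma less_level: "x < 2 ^ Suc (level x)"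
  unfolding level_def by (rule LeastI[of _ x]) (rule less_trans[OF less_exp], simp)

lemma level_subset: "{x. P x \<and> level x = r} \<subseteq> {..<2 ^ Suc r}"
proof
  fix x assume "x \<in> {x. P x \<and> level x = r}"
  then show "x \<in> {..<2 ^ Suc r}" using less_level[of x] by blast
qed

lemma column_exists: "\<exists>e. x = 0 \<or> \<not> 2 ^ Suc e dvd (x::nat)"
proof -
  have "x < 2 ^ Suc x" by (rule less_trans[OF less_exp]) simp
  then have "x = 0 \<or> \<not> 2 ^ Suc x dvd x" using nat_dvd_not_less by blast
  then show ?thesis by blast
qed

lemma column_eqI:
  assumes "2 ^ e dvd x" "\<not> 2 ^ Suc e dvd x"
  shows "column x = e"
  unfolding column_def
proof (rule Least_equality)
  fix d assume d: "x = 0 \<or> \<not> 2 ^ Suc d dvd x"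
  show "e \<le> d"
  proof (rule ccontr)
    assume "\<not> e \<le> d"
    then have "(2::nat) ^ Suc d dvd 2 ^ e" by (intro le_imp_power_dvd) simp
    then have "2 ^ Suc d dvd x" using assms(1) by (rule dvd_trans)
    moreover have "x \<noteq> 0" using assms(2) by (metis dvd_0_right)
    ultimately show False using d by blast
  qed
qed (use assms in blast)

lemma power_dvd_if_le_column:
  assumes "m \<le> column x"
  shows "2 ^ m dvd x"
proof (cases m)
  case (Suc e)
  with assms have "e < column x" by simp
  then have "\<not> (x = 0 \<or> \<not> 2 ^ Suc e dvd x)" unfolding column_def by (rule not_less_Least)
  with Suc show ?thesis by blast
qed simp

lemma computable_level: "computable_fun a \<Longrightarrow> computable_fun (\<lambda>x. level (a x))"
proof (rule computable_comp[where f = level])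
  have "computable_fun (\<lambda>x. level x)"
    unfolding level_def
    by (rule computable_Least, intro computable_intros) (blast intro: less_level)
  then show "computable_fun level" .
qed

lemma computable_column: "computable_fun a \<Longrightarrow> computable_fun (\<lambda>x. column (a x))"
proof (rule computable_comp[where f = column])
  have "computable_fun (\<lambda>x. column x)"
    unfolding column_def
    by (rule computable_Least, intro computable_intros) (rule column_exists)
  then show "computable_fun column" .
qed

section \<open>Density of sets described by columns and blocks\<close>

lemma density_ratio_le_1: "real (card (S \<inter> {..<n})) / real n \<le> 1"
proof -
  have "card (S \<inter> {..<n}) \<le> n" using card_mono[of "{..<n}" "S \<inter> {..<n}"] by simp
  then show ?thesis by (simp add: divide_le_eq)
qed

lemma density_1I:
  assumes "\<And>\<epsilon>. 0 < \<epsilon> \<Longrightarrow> \<exists>n0. \<forall>n\<ge>n0. 1 - \<epsilon> < real (card (S \<inter> {..<n})) / real n"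
  shows "density_1 S"
  unfolding density_1_def
proof (rule LIMSEQ_I)
  fix \<epsilon> :: real assume "0 < \<epsilon>"
  from assms[OF this] obtain n0 where n0: "\<And>n. n0 \<le> n \<Longrightarrow> 1 - \<epsilon> < real (card (S \<inter> {..<n})) / real n"
    by blast
  have "norm (real (card (S \<inter> {..<n})) / real n - 1) < \<epsilon>" if "n0 \<le> n" for n
    using n0[OF that] density_ratio_le_1[of S n] by (simp add: abs_less_iff)
  then show "\<exists>n0. \<forall>n\<ge>n0. norm (real (card (S \<inter> {..<n})) / real n - 1) < \<epsilon>" by blast
qed

lemma density_1D:
  assumes "density_1 S" "0 < \<epsilon>"
  shows "\<exists>n0. \<forall>n\<ge>n0. 1 - \<epsilon> < real (card (S \<inter> {..<n})) / real n"
proof -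
  from LIMSEQ_D[OF assms(1)[unfolded density_1_def] assms(2)] obtain n0 where
    n0: "\<And>n. n0 \<le> n \<Longrightarrow> norm (real (card (S \<inter> {..<n})) / real n - 1) < \<epsilon>" by blast
  have "1 - \<epsilon> < real (card (S \<inter> {..<n})) / real n" if "n0 \<le> n" for n
    using n0[OF that] by (simp add: abs_less_iff)
  then show ?thesis by blast
qed

lemma density_1_mono:
  assumes "density_1 S" "S \<subseteq> T"
  shows "density_1 T"
proof (rule density_1I)
  fix \<epsilon> :: real assume "0 < \<epsilon>"
  from density_1D[OF assms(1) this] obtain n0 where
    n0: "\<And>n. n0 \<le> n \<Longrightarrow> 1 - \<epsilon> < real (card (S \<inter> {..<n})) / real n" by blast
  have "1 - \<epsilon> < real (card (T \<inter> {..<n})) / real n" if "n0 \<le> n" for n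
  proof -
    have "card (S \<inter> {..<n}) \<le> card (T \<inter> {..<n})" using assms(2) by (intro card_mono) auto
    then have "real (card (S \<inter> {..<n})) / real n \<le> real (card (T \<inter> {..<n})) / real n"
      by (intro divide_right_mono) simp_all
    with n0[OF that] show ?thesis by linarith
  qed
  then show "\<exists>n0. \<forall>n\<ge>n0. 1 - \<epsilon> < real (card (T \<inter> {..<n})) / real n" by blast
qed

lemma card_multiples_le:
  assumes "0 < d"
  shows "card {x \<in> {..<n}. d dvd x} \<le> Suc (n div d)"
proof -
  have "{x \<in> {..<n}. d dvd x} \<subseteq> (\<lambda>q. d * q) ` {..n div d}"
  proof
    fix x assume "x \<in> {x \<in> {..<n}. d dvd x}"
    then have "x = d * (x div d)" "x div d \<le> n div d" by (auto intro: div_le_mono)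
    then show "x \<in> (\<lambda>q. d * q) ` {..n div d}" by blast
  qed
  then have "card {x \<in> {..<n}. d dvd x} \<le> card ((\<lambda>q. d * q) ` {..n div d})"
    by (intro card_mono) auto
  also have "\<dots> \<le> card {..n div d}" by (intro card_image_le) auto
  finally show ?thesis by simp
qed

text \<open>The complement of \<open>S\<close> has finitely many elements in the first
  \<open>m\<close> columns; all others are multiples of \<open>2 ^ m\<close> and have density at
  most \<open>2 ^ - m\<close>.\<close>

lemma density_1_if_columns_cofinite:
  assumes "\<And>e. finite {x. x \<notin> S \<and> column x = e}"
  shows "density_1 S"
proof (rule density_1I)
  fix \<epsilon> :: real assume "0 < \<epsilon>"
  then obtain m where m: "(1 / 2) ^ m < \<epsilon> / 2"
    using real_arch_pow_inv[of "\<epsilon> / 2" "1 / 2"] by auto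
  define F where "F = (\<Union>e<m. {x. x \<notin> S \<and> column x = e})"
  have fin: "finite F" unfolding F_def using assms by blast
  \<comment> \<open>Beyond \<open>n0\<close> the exceptions in \<open>F\<close>, together with the
    rounding error 1 in counting multiples, make up less than \<open>\<epsilon> / 2\<close>.\<close>
  obtain n0 :: nat where n0: "2 * (real (card F) + 1) / \<epsilon> < real n0"
    using reals_Archimedean2 by blast
  have "1 - \<epsilon> < real (card (S \<inter> {..<n})) / real n" if "Suc n0 \<le> n" for n
  proof -
    have "{..<n} \<subseteq> (S \<inter> {..<n}) \<union> (F \<union> {x \<in> {..<n}. 2 ^ m dvd x})"
    proof
      fix x assume "x \<in> {..<n}"
      then show "x \<in> (S \<inter> {..<n}) \<union> (F \<union> {x \<in> {..<n}. 2 ^ m dvd x})"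
        using power_dvd_if_le_column[of m x] by (cases "column x < m") (auto simp: F_def)
    qed
    then have "card {..<n} \<le> card ((S \<inter> {..<n}) \<union> (F \<union> {x \<in> {..<n}. 2 ^ m dvd x}))"
      by (intro card_mono) (auto simp: fin)
    also have "\<dots> \<le> card (S \<inter> {..<n}) + (card F + card {x \<in> {..<n}. 2 ^ m dvd x})"
      by (intro order.trans[OF card_Un_le] add_left_mono card_Un_le)
    also have "\<dots> \<le> card (S \<inter> {..<n}) + (card F + Suc (n div 2 ^ m))"
      using card_multiples_le[of "2 ^ m" n] by simp
    finally have "real n \<le> real (card (S \<inter> {..<n})) + (real (card F) + 1 + real (n div 2 ^ m))"
      by simp
    moreover have "real (n div 2 ^ m) \<le> real n * (1 / 2) ^ m"
      using of_nat_div_le_of_nat[of n "2 ^ m", where 'a = real] by (simp add: power_one_over field_simps)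
    moreover have "real n * (1 / 2) ^ m \<le> real n * (\<epsilon> / 2)"
      using m by (intro mult_left_mono) auto
    moreover have "real (card F) + 1 < real n * (\<epsilon> / 2)"
    proof -
      have "2 * (real (card F) + 1) / \<epsilon> < real n" using n0 that by linarith
      then show ?thesis using \<open>0 < \<epsilon>\<close> by (simp add: field_simps)
    qed
    ultimately have "(1 - \<epsilon>) * real n < real (card (S \<inter> {..<n}))"
      by (simp add: algebra_simps)
    moreover have "0 < real n" using that by simp
    ultimately show ?thesis by (simp add: less_divide_eq)
  qed
  then show "\<exists>n0. \<forall>n\<ge>n0. 1 - \<epsilon> < real (card (S \<inter> {..<n})) / real n" by blast
qed

text \<open>The block contains \<open>2 ^ e * (2 * q + 1)\<close> for every \<open>q\<close> with
  exactly \<open>k + 1\<close> binary digits.\<close>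

lemma card_block_ge: "2 ^ k \<le> card {x. column x = e \<and> level x = Suc (e + k)}"
proof -
  let ?f = "\<lambda>q. 2 ^ e * (2 * q + 1) :: nat"
  have "?f ` {2 ^ k..<2 ^ Suc k} \<subseteq> {x. column x = e \<and> level x = Suc (e + k)}"
  proof (rule image_subsetI)
    fix q :: nat assume q: "q \<in> {2 ^ k..<2 ^ Suc k}"
    have "column (?f q) = e"
    proof (rule column_eqI)
      show "\<not> 2 ^ Suc e dvd ?f q" unfolding power_Suc2 nat_mult_dvd_cancel_disj by simp
    qed (rule dvd_triv_left)
    moreover have "level (?f q) = Suc (e + k)"
    proof (rule level_eqI)
      have "2 ^ e * 2 ^ Suc k \<le> ?f q" using q by (intro mult_left_mono) auto
      then show "2 ^ Suc (e + k) \<le> ?f q" by (simp add: power_add)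
      have "?f q < 2 ^ e * 2 ^ Suc (Suc k)" using q by (intro mult_strict_left_mono) auto
      then show "?f q < 2 ^ Suc (Suc (e + k))" by (simp add: power_add)
    qed
    ultimately show "?f q \<in> {x. column x = e \<and> level x = Suc (e + k)}" by simp
  qed
  moreover have "finite {x. column x = e \<and> level x = Suc (e + k)}"
    by (rule finite_subset[OF level_subset finite_lessThan])
  ultimately have "card (?f ` {2 ^ k..<2 ^ Suc k}) \<le> card {x. column x = e \<and> level x = Suc (e + k)}"
    by (intro card_mono)
  moreover have "card (?f ` {2 ^ k..<2 ^ Suc k}) = 2 ^ k"
    by (subst card_image) (auto intro!: inj_onI)
  ultimately show ?thesis by simp
qed

text \<open>A missing block at level \<open>r = Suc (e + k)\<close> removes at least
  \<open>2 ^ k\<close> of the \<open>2 ^ Suc r\<close> numbers below \<open>2 ^ Suc r\<close>. This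
  fraction \<open>2 ^ - (e + 2)\<close> does not depend on \<open>r\<close>, and \<open>r\<close>
  can be arbitrarily large.\<close>

lemma not_density_1_if_blocks_missing:
  assumes inf: "infinite {r. \<forall>x. column x = e \<and> level x = r \<longrightarrow> x \<notin> S}"
  shows "\<not> density_1 S"
proof
  assume "density_1 S"
  from density_1D[OF this, of "(1 / 2) ^ (e + 2)"] obtain n0 where
    n0: "\<And>n. n0 \<le> n \<Longrightarrow> 1 - (1 / 2) ^ (e + 2) < real (card (S \<inter> {..<n})) / real n" by auto
  from inf obtain r where "\<not> r < Suc (e + n0)"
    and r: "\<And>x. column x = e \<Longrightarrow> level x = r \<Longrightarrow> x \<notin> S"
    unfolding finite_nat_set_iff_bounded by blast
  then have "e + n0 < r" by simp
  define k where "k = r - Suc e"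
  from \<open>e + n0 < r\<close> have rk: "r = Suc (e + k)" by (simp add: k_def)
  let ?n = "2 ^ Suc r :: nat" and ?C = "{x. column x = e \<and> level x = r}"
  have C: "?C \<subseteq> {..<?n}" by (rule level_subset)
  have "S \<inter> {..<?n} \<subseteq> {..<?n} - ?C" using r by blast
  then have "card (S \<inter> {..<?n}) \<le> card ({..<?n} - ?C)" by (intro card_mono) auto
  also have "\<dots> = ?n - card ?C"
    using C by (subst card_Diff_subset) (auto intro: finite_subset)
  also have "\<dots> \<le> ?n - 2 ^ k" using card_block_ge[of k e] unfolding rk by (rule diff_le_mono2)
  finally have "real (card (S \<inter> {..<?n})) \<le> real (?n - 2 ^ k)" by (simp only: of_nat_le_iff)
  also have "\<dots> = real ?n - real (2 ^ k)"
    by (rule of_nat_diff) (simp only: rk, rule power_increasing, simp_all)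
  also have "real (2 ^ k) = real ?n * (1 / 2) ^ (e + 2)"
    by (simp add: rk power_add power_one_over)
  finally have "real (card (S \<inter> {..<?n})) \<le> real ?n - real ?n * (1 / 2) ^ (e + 2)" .
  moreover have "c / m \<le> 1 - d" if "c \<le> m - m * d" "0 < m" for c m d :: real
    unfolding pos_divide_le_eq[OF that(2)] using that(1) by (simp add: algebra_simps)
  ultimately have "real (card (S \<inter> {..<?n})) / real ?n \<le> 1 - (1 / 2) ^ (e + 2)" by simp
  moreover have "n0 \<le> ?n"
    using \<open>e + n0 < r\<close> less_exp[of "Suc r"] by linarith
  ultimately show False using n0[of ?n] by linarith
qed

section \<open>The density-1 set\<close>

text \<open>The column \<open>e\<close> is at the same time the code of the program run on its
  blocks. The explicit bound on \<open>x\<close> makes the search through a block decidable.\<close>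

definition hit :: "nat \<Rightarrow> nat \<Rightarrow> nat \<Rightarrow> bool" where
  "hit e r s \<longleftrightarrow> (\<exists>x<2 ^ Suc r. column x = e \<and> level x = r \<and> halts_in s (eval_conf e x 0) 1)"

lemma decidable_hit: "decidable (\<lambda>z. hit (p1 z) (p1 (p2 z)) (p2 (p2 z)))"
  unfolding hit_def
  by (intro computable_intros computable_column computable_level computable_funpow computable_step)

interpretation hits: monotone_hits "hit e" for e
proof
  fix r s t
  assume "hit e r s" "s \<le> t"
  then show "hit e r t" unfolding hit_def using halts_in_mono by blast
qed

text \<open>The string whose incompatibility with \<open>A\<close> the number \<open>x\<close> asserts.\<close>

definition tag :: "nat \<Rightarrow> nat" where
  "tag x = target (hit (column x)) (level x)"

lemma computable_tag: "computable_fun a \<Longrightarrow> computable_fun (\<lambda>x. tag (a x))"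
  unfolding tag_def by (intro computable_target decidable_hit computable_column computable_level)

text \<open>The string coded by \<open>t\<close> has a bit at position \<open>n\<close>, and this bit is not \<open>b\<close>.\<close>

definition differs :: "nat \<Rightarrow> nat \<Rightarrow> nat \<Rightarrow> bool" where
  "differs n b t \<longleftrightarrow>
    (\<exists>i<t. 2 ^ Suc n \<le> t div 2 ^ i \<and> t div 2 ^ i < 2 ^ Suc (Suc n) \<and> t div 2 ^ i mod 2 \<noteq> b)"

lemma decidable_differs:
  "computable_fun a \<Longrightarrow> computable_fun b \<Longrightarrow> computable_fun c \<Longrightarrow>
    decidable (\<lambda>x. differs (a x) (b x) (c x))"
proof -
  have "decidable (\<lambda>z. differs (p1 z) (p1 (p2 z)) (p2 (p2 z)))"
    unfolding differs_def by (intro computable_intros)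
  then show "computable_fun a \<Longrightarrow> computable_fun b \<Longrightarrow> computable_fun c \<Longrightarrow> ?thesis"
    unfolding decidable_def by (rule computable_comp3)
qed

lemma differs_path_code:
  assumes "differs n b (path_code A k)"
  shows "b \<noteq> of_bool (n \<in> A)"
proof -
  from assms obtain i where i: "2 ^ Suc n \<le> path_code A k div 2 ^ i"
    "path_code A k div 2 ^ i < 2 ^ Suc (Suc n)" "path_code A k div 2 ^ i mod 2 \<noteq> b"
    unfolding differs_def by blast
  from i(1) have "0 < path_code A k div 2 ^ i" by (rule less_le_trans[rotated]) simp
  from prefix_codeI[OF this] obtain j where j: "path_code A k div 2 ^ i = path_code A j"
    by (rule prefix_code_path_code)
  \<comment> \<open>The bounds in \<open>differs\<close> force the prefix to have length
    \<open>Suc n\<close>, so its last bit is bit \<open>n\<close> of \<open>A\<close>.\<close>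
  have "(2::nat) ^ Suc n < 2 ^ Suc j" "(2::nat) ^ j < 2 ^ Suc (Suc n)"
    using i(1,2) path_code_ge[of j A] path_code_less[of A j] unfolding j by linarith+
  then have "Suc n < Suc j" "j < Suc (Suc n)"
    by (simp_all only: power_strict_increasing_iff one_less_numeral_iff semiring_norm)
  then have "j = Suc n" by simp
  with i(3) j show ?thesis by auto
qed

lemma differs_if_prefix_code:
  assumes "prefix_code (path_code X (Suc n)) t" "b \<noteq> of_bool (n \<in> X)"
  shows "differs n b t"
proof -
  from assms(1) obtain i where i: "i < t" "t div 2 ^ i = path_code X (Suc n)"
    unfolding prefix_code_def by blast
  have "2 ^ Suc n \<le> t div 2 ^ i" "t div 2 ^ i < 2 ^ Suc (Suc n)"
    unfolding i(2) by (rule path_code_ge path_code_less)+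
  moreover have "t div 2 ^ i mod 2 \<noteq> b" unfolding i(2) using assms(2) by auto
  ultimately show ?thesis using i(1) unfolding differs_def by blast
qed

abbreviation refutes :: "nat \<Rightarrow> nat \<Rightarrow> bool" where
  "refutes z t \<equiv> differs (p1 z) (p1 (p2 z)) t"

text \<open>The functional searches all numbers for an element of the oracle that refutes the tag.
  Each test is total, so the search diverges only if there is none.\<close>

lemma refuting_functional:
  obtains \<phi> where
    "\<And>Q x. run Q \<phi> x = (if \<exists>z\<in>Q. refutes z (tag x) then Some 1 else None)"
proof -
  have "computable_fun (\<lambda>y. if p1 y = 1 \<and> refutes (p2 (p2 y)) (tag (p1 (p2 y))) then 0 else 1)"
    by (intro computable_intros decidable_differs computable_tag)
  then obtain g where g: "oracle_free g"
    "\<And>Q y. run Q g y = Some (if p1 y = 1 \<and> refutes (p2 (p2 y)) (tag (p1 (p2 y))) then 0 else 1)"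
    by (rule computable_funE) (rule that)
  obtain one where one: "oracle_free one" "\<And>Q y. run Q one y = Some 1"
    using computable_const[of 1] by (rule computable_funE) (rule that)
  \<comment> \<open>On \<open>pr x z\<close> this passes to \<open>g\<close> the oracle's answer
    about \<open>z\<close>, followed by the input itself.\<close>
  define \<psi> where "\<psi> = Comp_m g (Pair_m (Comp_m Query_m Snd_m) (Pair_m Fst_m Snd_m))"
  have \<psi>: "run Q \<psi> (pr x z) = Some (if z \<in> Q \<and> refutes z (tag x) then 0 else 1)" for Q x z
    by (simp add: \<psi>_def g)
  show thesis
  proof (rule that)
    fix Q x
    have "(\<exists>n. run Q \<psi> (pr x n) = Some 0 \<and> (\<forall>m<n. run Q \<psi> (pr x m) \<noteq> None)) \<longleftrightarrow>
        (\<exists>z\<in>Q. refutes z (tag x))"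
      unfolding \<psi> by auto
    then show "run Q (Comp_m one (Mu_m \<psi>)) x =
        (if \<exists>z\<in>Q. refutes z (tag x) then Some 1 else None)"
      by (simp add: one)
  qed
qed

lemma refutes_triple_code:
  "refutes (triple_code (n, x, l)) t \<longleftrightarrow> differs n (of_bool x) t"
  by (simp add: triple_code_def)

text \<open>The density-1 set that witnesses the theorem. It consists of whole blocks, as
  \<open>tag x\<close> depends only on column and level.\<close>

definition off_path :: "nat set \<Rightarrow> nat set" where
  "off_path A = {x. \<forall>k. tag x \<noteq> path_code A k}"

lemma refuted_in_off_path:
  assumes "partial_oracle P A" "z \<in> triple_code ` P" "refutes z (tag x)"
  shows "x \<in> off_path A"
proof -
  from assms(2) obtain n b l where z: "(n, b, l) \<in> P" "z = triple_code (n, b, l)" by auto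
  with assms(1) have "b = (n \<in> A)" unfolding partial_oracle_def by blast
  with assms(3) z(2) have differs: "differs n (of_bool (n \<in> A)) (tag x)" by (simp add: refutes_triple_code)
  show ?thesis
    unfolding off_path_def
  proof (intro CollectI allI notI)
    fix k assume "tag x = path_code A k"
    with differs have "differs n (of_bool (n \<in> A)) (path_code A k)" by simp
    from differs_path_code[OF this] show False by simp
  qed
qed

lemma limit_of_guesses:
  obtains X where "left_ce X"
    "\<And>k. \<exists>s0. \<forall>s\<ge>s0. k \<le> s \<and> guess (hit e) s div 2 ^ (s - k) = path_code X k"
proof -
  from hits.limit_exists[of e] obtain X where
    X: "\<And>k. \<exists>s0. \<forall>s\<ge>s0. k \<le> s \<and> guess (hit e) s div 2 ^ (s - k) = path_code X k" by blast
  moreover have "left_ce X"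
    by (rule hits.left_ce_limit[OF computable_guess[OF decidable_hit] X])
  ultimately show thesis using that by blast
qed

section \<open>The reduction to \<open>A\<close> and the failure of generic computability\<close>

context
  fixes A :: "nat set"
  assumes not_coarse: "\<And>X. left_ce X \<Longrightarrow> \<not> density_1 {n. n \<in> X \<longleftrightarrow> n \<in> A}"
begin

lemma finite_unrefuted:
  assumes "generic_oracle P A"
  shows "finite {x. \<not> (\<exists>z\<in>triple_code ` P. refutes z (tag x)) \<and> column x = e}"
proof -
  obtain X where X: "left_ce X"
    "\<And>k. \<exists>s0. \<forall>s\<ge>s0. k \<le> s \<and> guess (hit e) s div 2 ^ (s - k) = path_code X k"
    using limit_of_guesses[of e] by blast
  \<comment> \<open>Otherwise \<open>X\<close> would agree with \<open>A\<close> on a set of density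
    1.\<close>
  have "\<not> oracle_domain P \<subseteq> {n. n \<in> X \<longleftrightarrow> n \<in> A}"
    using not_coarse[OF X(1)] assms density_1_mono unfolding generic_oracle_def by blast
  then obtain n b l where n: "(n, b, l) \<in> P" "(n \<in> X) \<noteq> (n \<in> A)"
    unfolding oracle_domain_def by blast
  with assms have b: "b = (n \<in> A)"
    unfolding generic_oracle_def partial_oracle_def by blast
  \<comment> \<open>With \<open>Suc n\<close> bits of \<open>X\<close> the targets contain bit
    \<open>n\<close>, which is wrong for \<open>A\<close>.\<close>
  obtain s0 where s0: "\<And>s. s0 \<le> s \<Longrightarrow> prefix_code (path_code X (Suc n)) (target (hit e) s)"
    using hits.eventually_prefix_target[OF X(2), of "Suc n"] by blast
  have "x < 2 ^ Suc s0" if "\<not> (\<exists>z\<in>triple_code ` P. refutes z (tag x))" "column x = e" for x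
  proof (rule ccontr)
    assume *: "\<not> x < 2 ^ Suc s0"
    have "s0 \<le> level x"
    proof (rule ccontr)
      assume "\<not> s0 \<le> level x"
      then have "(2::nat) ^ Suc (level x) \<le> 2 ^ Suc s0" by (intro power_increasing) auto
      with * less_level[of x] show False by linarith
    qed
    from s0[OF this] that(2) have "prefix_code (path_code X (Suc n)) (tag x)" by (simp add: tag_def)
    then have "differs n (of_bool b) (tag x)"
      by (rule differs_if_prefix_code) (use n(2) b in auto)
    with that(1) n(1) show False using refutes_triple_code by blast
  qed
  then have "{x. \<not> (\<exists>z\<in>triple_code ` P. refutes z (tag x)) \<and> column x = e} \<subseteq> {..<2 ^ Suc s0}"
    by blast
  then show ?thesis by (rule finite_subset) simp
qed

text \<open>One functional serves all generic oracles: it only answers 1, correctly since the oracle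
  tells the truth about \<open>A\<close>, and it answers almost everywhere in each column.\<close>

lemma off_path_reducible: "off_path A \<le>\<^sub>g A"
proof -
  obtain \<phi> where
    \<phi>: "\<And>Q x. run Q \<phi> x = (if \<exists>z\<in>Q. refutes z (tag x) then Some 1 else None)"
    by (rule refuting_functional) (rule that)
  have "generic_computation (run (triple_code ` P) \<phi>) (off_path A)" if P: "generic_oracle P A" for P
  proof -
    have dom: "dom (run (triple_code ` P) \<phi>) = {x. \<exists>z\<in>triple_code ` P. refutes z (tag x)}"
      by (auto simp: \<phi> dom_def split: if_splits)
    have "density_1 (dom (run (triple_code ` P) \<phi>))"
      unfolding dom using finite_unrefuted[OF P]
      by (intro density_1_if_columns_cofinite) (simp only: mem_Collect_eq)
    moreover have "y = of_bool (x \<in> off_path A)" if "run (triple_code ` P) \<phi> x = Some y" for x y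
    proof -
      from that have y: "y = 1" and "\<exists>z\<in>triple_code ` P. refutes z (tag x)"
        unfolding \<phi> by (simp_all split: if_splits)
      then have "x \<in> off_path A"
        using refuted_in_off_path P unfolding generic_oracle_def by blast
      with y show ?thesis by simp
    qed
    ultimately show ?thesis unfolding generic_computation_def by blast
  qed
  then show ?thesis unfolding generic_reducible_def by blast
qed

text \<open>A concrete generic oracle, through which the finiteness of the unrefuted part of a
  column passes to the complement of \<open>off_path A\<close>.\<close>

definition full_oracle :: "(nat \<times> bool \<times> nat) set" where
  "full_oracle = range (\<lambda>n. (n, n \<in> A, 0))"

lemma generic_full_oracle: "generic_oracle full_oracle A"
proof -
  have "oracle_domain full_oracle = UNIV"
    by (auto simp: oracle_domain_def full_oracle_def)
  moreover have "density_1 UNIV" by (rule density_1_if_columns_cofinite) simp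
  ultimately show ?thesis
    unfolding generic_oracle_def by (auto simp: partial_oracle_def full_oracle_def)
qed

lemma finite_not_in_off_path: "finite {x. x \<notin> off_path A \<and> column x = e}"
  using refuted_in_off_path generic_full_oracle unfolding generic_oracle_def
  by (intro finite_subset[OF _ finite_unrefuted[OF generic_full_oracle, of e]]) blast

lemma off_path_not_computable: "\<not> generically_computable (off_path A)"
proof
  assume "generically_computable (off_path A)"
  then obtain p where gen: "generic_computation (run {} p) (off_path A)"
    unfolding generically_computable_def partial_computable_def by blast
  \<comment> \<open>The column used against \<open>p\<close> is the one numbered by its own
    code.\<close>
  define e where "e = machine_code p"
  have hitE: "\<exists>x. column x = e \<and> level x = r \<and> run {} p x = Some 1" if "hit e r s" for r s
    using that halts_in_iff_run[of p] unfolding hit_def e_def by blast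
  have truthful: "target (hit e) r \<noteq> path_code A k" if "hit e r s" for r s k
  proof -
    from hitE[OF that] obtain x where x: "column x = e" "level x = r" "run {} p x = Some 1" by blast
    from gen x(3) have "(1::nat) = of_bool (x \<in> off_path A)" unfolding generic_computation_def by blast
    then have "x \<in> off_path A" by (cases "x \<in> off_path A") auto
    then show ?thesis using x unfolding off_path_def tag_def by blast
  qed
  have avoid: "\<not> prefix_code (target (hit e) r) (guess (hit e) s)" if "r < s" "hit e r s" for r s
    by (rule guess_avoids[of "hit e" A]) (use truthful that in blast)+
  obtain X where X: "left_ce X"
    "\<And>k. \<exists>s0. \<forall>s\<ge>s0. k \<le> s \<and> guess (hit e) s div 2 ^ (s - k) = path_code X k"
    using limit_of_guesses[of e] by blast
  \<comment> \<open>At a level in \<open>?R - ?F\<close> the string is a prefix of \<open>X\<close>,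
    and the block lies inside \<open>off_path A\<close>. An output of \<open>p\<close> on the block
    would have to be 1 and thus a hit, which strings on \<open>X\<close> never receive.\<close>
  let ?R = "{r. \<exists>k. target (hit e) r = path_code X k}"
  let ?F = "level ` {x. x \<notin> off_path A \<and> column x = e}"
  have miss: "x \<notin> dom (run {} p)" if r: "level x \<in> ?R - ?F" and x: "column x = e" for x
  proof
    assume "x \<in> dom (run {} p)"
    then obtain y where y: "run {} p x = Some y" by blast
    with gen have "y = of_bool (x \<in> off_path A)" unfolding generic_computation_def by blast
    moreover have "x \<in> off_path A" using r x by blast
    ultimately have "run {} p x = Some 1" using y by simp
    then obtain s where "halts_in s (eval_conf e x 0) 1"
      using halts_in_iff_run[of p x 1] unfolding e_def by blast
    then have "hit e (level x) s" using x less_level[of x] unfolding hit_def by blast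
    moreover from r obtain k where "target (hit e) (level x) = path_code X k" by blast
    ultimately show False
      using hits.not_hit_if_target_path[of e X "level x" k s, OF X(2) avoid] by blast
  qed
  have "infinite (?R - ?F)"
    using hits.infinite_path_targets[OF X(2)] finite_not_in_off_path[of e]
    by (intro Diff_infinite_finite finite_imageI)
  moreover have "?R - ?F \<subseteq> {r. \<forall>x. column x = e \<and> level x = r \<longrightarrow> x \<notin> dom (run {} p)}"
    using miss by blast
  ultimately have "infinite {r. \<forall>x. column x = e \<and> level x = r \<longrightarrow> x \<notin> dom (run {} p)}"
    using finite_subset by blast
  then have "\<not> density_1 (dom (run {} p))" by (rule not_density_1_if_blocks_missing)
  with gen show False unfolding generic_computation_def by blast
qed

end

theorem mainTheorem2:
  fixes A :: "nat set"
  assumes "\<not> (\<exists>X. left_ce X \<and> density_1 {n. n \<in> X \<longleftrightarrow> n \<in> A})"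
  shows "density_1_bounding A"
proof -
  have not_coarse: "\<not> density_1 {n. n \<in> X \<longleftrightarrow> n \<in> A}" if "left_ce X" for X
    using assms that by blast
  have "density_1 (off_path A)"
    by (rule density_1_if_columns_cofinite) (rule finite_not_in_off_path[OF not_coarse])
  then show ?thesis
    unfolding density_1_bounding_def
    using off_path_not_computable[OF not_coarse] off_path_reducible[OF not_coarse] by blast
qed

end
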